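(* Let $A = k[\mathcal{G}] \times H$ be the biproduct constructed in the context from data $(G, \mathcal{G}, \mu, \theta, \mathbf{U})$, with $B = k[\mathcal{G}]$ and $H = k[G]$, where $\mathcal{G}$ is a finite abelian group. Suppose $k$ contains a primitive $|\mathcal{G}|^{th}$ root of unity. Then the one-one group homomorphism $$\Phi_{\mathcal{YD}} : \mathcal{N}(B, H)^{op} \rtimes_\varphi \mathrm{Aut}_{\mathcal{YD}-\mathrm{Hopf}}(B) \longrightarrow \mathrm{Aut}_{\mathrm{Hopf}}(A, \pi), \qquad \Phi_{\mathcal{YD}}(g, f)(b \times h) = f(b)g(h_{(1)}) \times h_{(2)},$$ is an isomorphism if any of the following hold: (a) $\boldsymbol{\theta}$ fixes a unique one-dimensional ideal of $k[\mathcal{G}]$. (b) The order of $\boldsymbol{\theta}$ and $|\mathcal{G}|$ are relatively prime. (c) $\boldsymbol{\theta}$ has order $p$, where $p$ is prime, and $p^2$ does not divide $|\mathcal{G}|$.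
   Context: Let $k$ be a field. The data. $G$ and $\mathcal{G}$ are groups, $\mu : G \to \mathrm{Aut}_{\mathrm{Group}}(\mathcal{G})$ is a group homomorphism, and $\theta \in \mathrm{Aut}_{\mathrm{Group}}(\mathcal{G})$ has finite orbits on $\mathcal{G}$. $\boldsymbol{\theta} : k[\mathcal{G}] \to k[\mathcal{G}]$ is the linear extension of $\theta$ and is assumed diagonalizable (i.e. $k[\mathcal{G}]$ is the sum of the eigenspaces $B_\lambda = \{b : \boldsymbol{\theta}(b) = \lambda b\}$, $\lambda \in k$). Assume $\mu(g) \circ \theta = \theta \circ \mu(g)$ for all $g \in G$, and that there is an isomorphism $\lambda \mapsto \boldsymbol{\lambda}$ from the subgroup $U \subseteq k^\times$ generated by the eigenvalues of $\boldsymbol{\theta}$ onto a subgroup $\mathbf{U}$ of $G$ with $\mathbf{U} \subseteq \mathrm{Ker}(\mu) \cap \mathrm{Z}(G)$. Let $H = k[G]$ and $B = k[\mathcal{G}]$ with their usual (group) Hopf algebra structures. $B$ is a left $H$-module by $g \cdot b = \mu(g)(b)$ for $g \in G$, $b \in \mathcal{G}$, and a left $H$-comodule by $\rho(b) = \boldsymbol{\lambda} \otimes b$ for $b \in B_\lambda$. With these structures $B$ is a Hopf algebra in the Yetter-Drinfel'd category ${}_H^H\mathcal{YD}$, and the biproduct $A = B \times H$ is the Hopf algebra over $k$ on $B \otimes H$ (tensors written $b \times h$) with product $(b \times h)(b' \times h') = b(h_{(1)}\cdot b') \times h_{(2)}h'$, unit $1 \times 1$, coproduct $\Delta(b \times h)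 = (b_{(1)} \times b_{(2)(-1)}h_{(1)}) \otimes (b_{(2)(0)} \times h_{(2)})$ and counit $\epsilon \otimes \epsilon$; here $\Delta(c) = c_{(1)} \otimes c_{(2)}$ and $\rho(b) = b_{(-1)} \otimes b_{(0)}$. Groups. $\pi : A \to H$ is $\pi(b \times h) = \epsilon(b)h$; $\mathrm{Aut}_{\mathrm{Hopf}}(A, \pi)$ is the group of Hopf algebra automorphisms $F$ of $A$ with $\pi \circ F = \pi$. For such $F$ define $F_L : B \to B$ and $F_R : H \to B$ by $F_L(b) = \Pi(F(b \times 1))$ and $F_R(h) = \Pi(F(1 \times h))$, where $\Pi(b \times h) = b\epsilon(h)$. $\mathrm{Aut}_{\mathcal{YD}-\mathrm{Hopf}}(B)$ is the group of bijective linear endomorphisms of $B$ which are algebra, coalgebra, left $H$-module and left $H$-comodule maps. $\mathcal{N}(B, H)$ is the set of all $F_R$ with $F \in \mathrm{Aut}_{\mathrm{Hopf}}(A, \pi)$ and $F_L = \mathrm{Id}_B$; it is a group under the convolution product $\star$ of $\mathrm{Hom}(H, B)$. $(\ )^{op}$ denotes opposite group, $\varphi(f)(g) = f \circ g$, and the semidirect product has multiplication $(g,f)(g',f') = ((f \circ g') \star g,\ f \circ f')$. *)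

theory Defs
  imports
    "HOL-Library.Poly_Mapping"
    "HOL-Library.Cardinality"
    "HOL-Algebra.Algebraic_Closure_Type"
    "HOL-Algebra.Multiplicative_Group"
    "HOL-Algebra.Bij"
begin

section \<open>Free vector spaces, tensor products, group algebras\<close>

text \<open>
  The vector space with basis \<open>'x\<close> over \<open>'k\<close> is \<open>'x \<Rightarrow>\<^sub>0 'k\<close>; the tensor product of the spaces with
  bases \<open>'x\<close> and \<open>'y\<close> is the space with basis \<open>'x \<times> 'y\<close>.  Groups are types of class
  \<open>group_add\<close>, which is the class of not necessarily commutative groups, so the group law is
  written additively. The group algebra is \<open>'g \<Rightarrow>\<^sub>0 'k\<close> with the convolution product of
  \<^theory>\<open>HOL-Library.Poly_Mapping\<close>, whose unit is the basis vector of the neutral element.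
\<close>

abbreviation delta :: "'x \<Rightarrow> 'x \<Rightarrow>\<^sub>0 'k::field" where
  "delta x \<equiv> Poly_Mapping.single x 1"

definition scale :: "'k::field \<Rightarrow> ('x \<Rightarrow>\<^sub>0 'k) \<Rightarrow> ('x \<Rightarrow>\<^sub>0 'k)" where
  "scale c v = Poly_Mapping.map ((*) c) v"

lemma lookup_scale [simp]:
  "Poly_Mapping.lookup (scale c v) x = c * Poly_Mapping.lookup v x"
  by (simp add: scale_def Poly_Mapping.map.rep_eq when_def)

interpretation fm: vector_space scale
  by unfold_locales (auto intro!: poly_mapping_eqI simp: lookup_add algebra_simps)

abbreviation klinear :: "(('x \<Rightarrow>\<^sub>0 'k::field) \<Rightarrow> ('y \<Rightarrow>\<^sub>0 'k)) \<Rightarrow> bool" where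
  "klinear \<equiv> Vector_Spaces.linear scale scale"

definition lin_ext :: "('x \<Rightarrow> ('y \<Rightarrow>\<^sub>0 'k)) \<Rightarrow> ('x \<Rightarrow>\<^sub>0 'k::field) \<Rightarrow> ('y \<Rightarrow>\<^sub>0 'k)" where
  "lin_ext f v = (\<Sum>x\<in>Poly_Mapping.keys v. scale (Poly_Mapping.lookup v x) (f x))"

definition tensor :: "('x \<Rightarrow>\<^sub>0 'k::field) \<Rightarrow> ('y \<Rightarrow>\<^sub>0 'k) \<Rightarrow> ('x \<times> 'y \<Rightarrow>\<^sub>0 'k)" where
  "tensor u v = lin_ext (\<lambda>x. lin_ext (\<lambda>y. delta (x, y)) v) u"

definition tensor_map ::
  "(('x \<Rightarrow>\<^sub>0 'k::field) \<Rightarrow> ('x' \<Rightarrow>\<^sub>0 'k)) \<Rightarrow> (('y \<Rightarrow>\<^sub>0 'k) \<Rightarrow> ('y' \<Rightarrow>\<^sub>0 'k))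
    \<Rightarrow> ('x \<times> 'y \<Rightarrow>\<^sub>0 'k) \<Rightarrow> ('x' \<times> 'y' \<Rightarrow>\<^sub>0 'k)" where
  "tensor_map S T = lin_ext (\<lambda>(x, y). tensor (S (delta x)) (T (delta y)))"

definition galg_comult :: "('x \<Rightarrow>\<^sub>0 'k::field) \<Rightarrow> ('x \<times> 'x \<Rightarrow>\<^sub>0 'k)" where
  "galg_comult = lin_ext (\<lambda>x. delta (x, x))"

definition galg_counit :: "('x \<Rightarrow>\<^sub>0 'k::field) \<Rightarrow> 'k" where
  "galg_counit v = (\<Sum>x\<in>Poly_Mapping.keys v. Poly_Mapping.lookup v x)"

text \<open>Sweedler notation: \<open>sweedler E v\<close> is the sum of \<open>E v\<^sub>1 v\<^sub>2\<close>
  over the tensor \<open>v = \<Sum> v\<^sub>1 \<otimes> v\<^sub>2\<close>, for bilinear \<open>E\<close>.\<close>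

definition sweedler ::
  "(('x \<Rightarrow>\<^sub>0 'k) \<Rightarrow> ('y \<Rightarrow>\<^sub>0 'k) \<Rightarrow> ('z \<Rightarrow>\<^sub>0 'k)) \<Rightarrow> ('x \<times> 'y \<Rightarrow>\<^sub>0 'k::field) \<Rightarrow> ('z \<Rightarrow>\<^sub>0 'k)" where
  "sweedler E = lin_ext (\<lambda>(x, y). E (delta x) (delta y))"

section \<open>Groups as records\<close>

definition grp :: "'g::group_add monoid" where
  "grp = \<lparr>carrier = UNIV, monoid.mult = (+), one = 0\<rparr>"

definition center :: "('a, 'm) monoid_scheme \<Rightarrow> 'a set" where
  "center G = {z \<in> carrier G. \<forall>x \<in> carrier G. z \<otimes>\<^bsub>G\<^esub> x = x \<otimes>\<^bsub>G\<^esub> z}"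

definition opposite_group :: "'a monoid \<Rightarrow> 'a monoid" where
  "opposite_group G = \<lparr>carrier = carrier G, monoid.mult = (\<lambda>x y. y \<otimes>\<^bsub>G\<^esub> x), one = \<one>\<^bsub>G\<^esub>\<rparr>"

definition semidirect :: "'a monoid \<Rightarrow> 'b monoid \<Rightarrow> ('b \<Rightarrow> 'a \<Rightarrow> 'a) \<Rightarrow> ('a \<times> 'b) monoid" where
  "semidirect N K \<phi> =
    \<lparr>carrier = carrier N \<times> carrier K,
     monoid.mult = (\<lambda>(n, k) (n', k'). (n \<otimes>\<^bsub>N\<^esub> \<phi> k n', k \<otimes>\<^bsub>K\<^esub> k')),
     one = (\<one>\<^bsub>N\<^esub>, \<one>\<^bsub>K\<^esub>)\<rparr>"

section \<open>The data\<close>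

definition eigenspace :: "(('x \<Rightarrow>\<^sub>0 'k) \<Rightarrow> ('x \<Rightarrow>\<^sub>0 'k)) \<Rightarrow> 'k::field \<Rightarrow> ('x \<Rightarrow>\<^sub>0 'k) set" where
  "eigenspace T l = {v. T v = scale l v}"

definition units_group :: "'k::field monoid" where
  "units_group = mult_of (ring_of_type_algebra :: 'k ring)"

definition eigenvalue_group :: "(('x \<Rightarrow>\<^sub>0 'k) \<Rightarrow> ('x \<Rightarrow>\<^sub>0 'k)) \<Rightarrow> 'k::field set" where
  "eigenvalue_group T = generate units_group {l. eigenspace T l \<noteq> {0}}"

definition lin_of :: "('x \<Rightarrow> 'y) \<Rightarrow> ('x \<Rightarrow>\<^sub>0 'k::field) \<Rightarrow> ('y \<Rightarrow>\<^sub>0 'k)" where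
  "lin_of t = lin_ext (\<lambda>x. delta (t x))"

text \<open>\<open>emb\<close> is the isomorphism from the group generated by the eigenvalues onto the central subgroup
  \<open>V\<close>; its values outside that group are irrelevant.\<close>

locale biproduct_data =
  fixes \<mu> :: "'g::group_add \<Rightarrow> 'c::group_add \<Rightarrow> 'c"
    and \<theta> :: "'c \<Rightarrow> 'c"
    and emb :: "'k::field \<Rightarrow> 'g"
    and V :: "'g set"
  assumes \<mu>_hom: "\<mu> \<in> hom grp (AutoGroup grp)"
    and \<theta>_auto: "\<theta> \<in> carrier (AutoGroup grp)"
    and \<theta>_finite_orbits: "\<And>x. finite (range (\<lambda>n. (\<theta> ^^ n) x))"
    and \<theta>_diagonalizable:
      "fm.span (\<Union>l::'k. eigenspace (lin_of \<theta>) l) = (UNIV :: ('c \<Rightarrow>\<^sub>0 'k) set)"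
    and \<mu>_\<theta>_commute: "\<And>g. \<mu> g \<circ> \<theta> = \<theta> \<circ> \<mu> g"
    and V_subgroup: "subgroup V grp"
    and V_central: "V \<subseteq> kernel grp (AutoGroup grp) \<mu> \<inter> center grp"
    and emb_iso: "emb \<in> iso (units_group\<lparr>carrier := eigenvalue_group (lin_of \<theta> :: ('c \<Rightarrow>\<^sub>0 'k) \<Rightarrow> _)\<rparr>)
                           (grp\<lparr>carrier := V\<rparr>)"

section \<open>The Yetter--Drinfel'd structure of \<open>B\<close> and the biproduct \<open>A = B \<times> H\<close>\<close>

definition act :: "('g \<Rightarrow> 'c \<Rightarrow> 'c) \<Rightarrow> ('g \<Rightarrow>\<^sub>0 'k::field) \<Rightarrow> ('c \<Rightarrow>\<^sub>0 'k) \<Rightarrow> ('c \<Rightarrow>\<^sub>0 'k)" where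
  "act \<mu> h b = lin_ext (\<lambda>g. lin_of (\<mu> g) b) h"

text \<open>For diagonalizable \<open>lin_of \<theta>\<close> the eigenspaces have direct sum \<open>B\<close>, so exactly one linear map
  has the property below.\<close>

definition coact :: "('c \<Rightarrow> 'c) \<Rightarrow> ('k \<Rightarrow> 'g) \<Rightarrow> ('c \<Rightarrow>\<^sub>0 'k::field) \<Rightarrow> ('g \<times> 'c \<Rightarrow>\<^sub>0 'k)" where
  "coact \<theta> emb = (THE \<rho>. klinear \<rho> \<and>
     (\<forall>l. \<forall>b \<in> eigenspace (lin_of \<theta>) l. \<rho> b = tensor (delta (emb l)) b))"

definition bip_mult ::
  "('g::group_add \<Rightarrow> 'c::group_add \<Rightarrow> 'c) \<Rightarrow> ('c \<times> 'g \<Rightarrow>\<^sub>0 'k::field) \<Rightarrow> ('c \<times> 'g \<Rightarrow>\<^sub>0 'k)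
    \<Rightarrow> ('c \<times> 'g \<Rightarrow>\<^sub>0 'k)" where
  "bip_mult \<mu> u v =
     sweedler (\<lambda>b h. sweedler (\<lambda>b' h'.
       sweedler (\<lambda>h1 h2. tensor (b * act \<mu> h1 b') (h2 * h')) (galg_comult h)) v) u"

definition bip_one :: "'c::group_add \<times> 'g::group_add \<Rightarrow>\<^sub>0 'k::field" where
  "bip_one = tensor 1 1"

definition bip_comult ::
  "('c \<Rightarrow> 'c) \<Rightarrow> ('k \<Rightarrow> 'g) \<Rightarrow> ('c::group_add \<times> 'g::group_add \<Rightarrow>\<^sub>0 'k::field)
    \<Rightarrow> (('c \<times> 'g) \<times> ('c \<times> 'g) \<Rightarrow>\<^sub>0 'k)" where
  "bip_comult \<theta> emb =
     sweedler (\<lambda>b h.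
       sweedler (\<lambda>b1 b2. sweedler (\<lambda>h1 h2. sweedler (\<lambda>u b0.
         tensor (tensor b1 (u * h1)) (tensor b0 h2))
           (coact \<theta> emb b2)) (galg_comult h)) (galg_comult b))"

definition bip_counit :: "('c \<times> 'g \<Rightarrow>\<^sub>0 'k::field) \<Rightarrow> 'k" where
  "bip_counit v = (\<Sum>(b, h)\<in>Poly_Mapping.keys v.
     Poly_Mapping.lookup v (b, h) * (galg_counit (delta b :: _ \<Rightarrow>\<^sub>0 'k) * galg_counit (delta h :: _ \<Rightarrow>\<^sub>0 'k)))"

definition bip_pi :: "('c \<times> 'g \<Rightarrow>\<^sub>0 'k::field) \<Rightarrow> ('g \<Rightarrow>\<^sub>0 'k)" where
  "bip_pi = sweedler (\<lambda>b h. scale (galg_counit b) h)"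

definition bip_Pi :: "('c \<times> 'g \<Rightarrow>\<^sub>0 'k::field) \<Rightarrow> ('c \<Rightarrow>\<^sub>0 'k)" where
  "bip_Pi = sweedler (\<lambda>b h. scale (galg_counit h) b)"

section \<open>The groups\<close>

text \<open>Maps of Hopf algebras are maps of bialgebras: compatibility with antipodes is automatic.\<close>

definition bialg_auto ::
  "(('x \<Rightarrow>\<^sub>0 'k) \<Rightarrow> ('x \<Rightarrow>\<^sub>0 'k) \<Rightarrow> ('x \<Rightarrow>\<^sub>0 'k)) \<Rightarrow> ('x \<Rightarrow>\<^sub>0 'k)
    \<Rightarrow> (('x \<Rightarrow>\<^sub>0 'k) \<Rightarrow> ('x \<times> 'x \<Rightarrow>\<^sub>0 'k)) \<Rightarrow> (('x \<Rightarrow>\<^sub>0 'k) \<Rightarrow> 'k)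
    \<Rightarrow> (('x \<Rightarrow>\<^sub>0 'k::field) \<Rightarrow> ('x \<Rightarrow>\<^sub>0 'k)) \<Rightarrow> bool" where
  "bialg_auto m e \<Delta> \<epsilon> F \<longleftrightarrow>
     klinear F \<and> bij F \<and>
     (\<forall>u v. F (m u v) = m (F u) (F v)) \<and> F e = e \<and>
     (\<forall>v. \<Delta> (F v) = tensor_map F F (\<Delta> v)) \<and> (\<forall>v. \<epsilon> (F v) = \<epsilon> v)"

definition Aut_Hopf ::
  "('g::group_add \<Rightarrow> 'c::group_add \<Rightarrow> 'c) \<Rightarrow> ('c \<Rightarrow> 'c) \<Rightarrow> ('k::field \<Rightarrow> 'g)
    \<Rightarrow> (('c \<times> 'g \<Rightarrow>\<^sub>0 'k) \<Rightarrow> ('c \<times> 'g \<Rightarrow>\<^sub>0 'k)) monoid" where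
  "Aut_Hopf \<mu> \<theta> emb =
    \<lparr>carrier = {F. bialg_auto (bip_mult \<mu>) bip_one (bip_comult \<theta> emb) bip_counit F \<and>
                   bip_pi \<circ> F = bip_pi},
     monoid.mult = (\<circ>), one = id\<rparr>"

definition Aut_YD_Hopf ::
  "('g::group_add \<Rightarrow> 'c::group_add \<Rightarrow> 'c) \<Rightarrow> ('c \<Rightarrow> 'c) \<Rightarrow> ('k::field \<Rightarrow> 'g)
    \<Rightarrow> (('c \<Rightarrow>\<^sub>0 'k) \<Rightarrow> ('c \<Rightarrow>\<^sub>0 'k)) monoid" where
  "Aut_YD_Hopf \<mu> \<theta> emb =
    \<lparr>carrier = {f. bialg_auto (*) 1 galg_comult galg_counit f \<and>
                   (\<forall>h b. f (act \<mu> h b) = act \<mu> h (f b)) \<and>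
                   (\<forall>b. coact \<theta> emb (f b) = tensor_map id f (coact \<theta> emb b))},
     monoid.mult = (\<circ>), one = id\<rparr>"

definition left_part ::
  "(('c::group_add \<times> 'g::group_add \<Rightarrow>\<^sub>0 'k::field) \<Rightarrow> ('c \<times> 'g \<Rightarrow>\<^sub>0 'k))
    \<Rightarrow> ('c \<Rightarrow>\<^sub>0 'k) \<Rightarrow> ('c \<Rightarrow>\<^sub>0 'k)" where
  "left_part F b = bip_Pi (F (tensor b 1))"

definition right_part ::
  "(('c::group_add \<times> 'g::group_add \<Rightarrow>\<^sub>0 'k::field) \<Rightarrow> ('c \<times> 'g \<Rightarrow>\<^sub>0 'k))
    \<Rightarrow> ('g \<Rightarrow>\<^sub>0 'k) \<Rightarrow> ('c \<Rightarrow>\<^sub>0 'k)" where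
  "right_part F h = bip_Pi (F (tensor 1 h))"

definition conv ::
  "(('g \<Rightarrow>\<^sub>0 'k::field) \<Rightarrow> ('c::group_add \<Rightarrow>\<^sub>0 'k)) \<Rightarrow> (('g \<Rightarrow>\<^sub>0 'k) \<Rightarrow> ('c \<Rightarrow>\<^sub>0 'k))
    \<Rightarrow> ('g \<Rightarrow>\<^sub>0 'k) \<Rightarrow> ('c \<Rightarrow>\<^sub>0 'k)" where
  "conv p q h = sweedler (\<lambda>h1 h2. p h1 * q h2) (galg_comult h)"

definition NBH ::
  "('g::group_add \<Rightarrow> 'c::group_add \<Rightarrow> 'c) \<Rightarrow> ('c \<Rightarrow> 'c) \<Rightarrow> ('k::field \<Rightarrow> 'g)
    \<Rightarrow> (('g \<Rightarrow>\<^sub>0 'k) \<Rightarrow> ('c \<Rightarrow>\<^sub>0 'k)) monoid" where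
  "NBH \<mu> \<theta> emb =
    \<lparr>carrier = {right_part F | F. F \<in> carrier (Aut_Hopf \<mu> \<theta> emb) \<and> left_part F = id},
     monoid.mult = conv, one = (\<lambda>h. scale (galg_counit h) 1)\<rparr>"

definition Phi_YD ::
  "(('g \<Rightarrow>\<^sub>0 'k::field) \<Rightarrow> ('c::group_add \<Rightarrow>\<^sub>0 'k)) \<times> (('c \<Rightarrow>\<^sub>0 'k) \<Rightarrow> ('c \<Rightarrow>\<^sub>0 'k))
    \<Rightarrow> ('c \<times> 'g \<Rightarrow>\<^sub>0 'k) \<Rightarrow> ('c \<times> 'g \<Rightarrow>\<^sub>0 'k)" where
  "Phi_YD = (\<lambda>(g, f). sweedler (\<lambda>b h. sweedler (\<lambda>h1 h2. tensor (f b * g h1) h2) (galg_comult h)))"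

section \<open>Hypotheses of the theorem\<close>

definition primitive_root_of_unity :: "nat \<Rightarrow> 'k::field \<Rightarrow> bool" where
  "primitive_root_of_unity n w \<longleftrightarrow> n > 0 \<and> w ^ n = 1 \<and> (\<forall>m. 0 < m \<and> m < n \<longrightarrow> w ^ m \<noteq> 1)"

definition one_dim_ideal :: "('c::group_add \<Rightarrow>\<^sub>0 'k::field) set \<Rightarrow> bool" where
  "one_dim_ideal I \<longleftrightarrow> ideal I (ring_of_type_algebra :: ('c \<Rightarrow>\<^sub>0 'k) ring) \<and> fm.dim I = 1"

definition bij_order :: "('a \<Rightarrow> 'a) \<Rightarrow> nat" where
  "bij_order T = group.ord (BijGroup UNIV) T"

end

theory Submission
  imports Defs
begin

text \<open>
  An automorphism \<open>F\<close> of \<open>A = B \<times> H\<close> over the projection \<open>\<pi>\<close> is determined by its two parts: from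
  \<open>(\<Pi> \<otimes> \<pi>) \<Delta> = id\<close> and \<open>\<pi> F = \<pi>\<close> one gets \<open>F (b \<times> g) = F\<^sub>L b \<cdot> F\<^sub>R g \<times> g\<close> for \<open>g\<close> in the group \<open>G\<close>
  (\<open>Aut_Hopf_tensor\<close>), which already has the shape of \<open>\<Phi> (F\<^sub>R, F\<^sub>L)\<close>. The question is only whether \<open>F\<^sub>L\<close> is
  an automorphism of the Yetter-Drinfel'd Hopf algebra \<open>B\<close>. Multiplicativity of \<open>F\<close> makes \<open>F\<^sub>L\<close> an
  algebra map, and, \<open>B\<close> being commutative and \<open>F\<^sub>R g\<close> a unit, a map of \<open>H\<close>-modules. Let \<open>E l\<close> be the
  projection of \<open>B\<close> onto the eigenspace of the linear extension of \<open>\<theta>\<close> for the eigenvalue \<open>l\<close>.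
  Comparing coproducts component by component shows that

  \<^item> \<open>F\<^sub>R g\<close> is an element \<open>shift F g\<close> of the finite abelian group fixed by \<open>\<theta>\<close>
    (\<open>right_part_grouplike\<close>);
  \<^item> \<open>F\<^sub>L\<close> commutes with all \<open>E l\<close>, so that it is a map of comodules (\<open>left_part_eigenproj\<close>);
  \<^item> \<open>\<Delta> (F\<^sub>L b) = (\<Sum>l. F\<^sub>L b \<cdot> s l \<otimes> F\<^sub>L (E l b))\<close> for group elements \<open>b\<close>, where
    \<open>s l = shift F (emb l)\<close> (\<open>galg_comult_left_part\<close>).

  Hence the only obstruction is \<open>s\<close>, a homomorphism from the group generated by the eigenvalues to
  the group of \<open>\<theta>\<close>-fixed elements. If \<open>s\<close> vanishes on the eigenvalues for every \<open>F\<close>, then \<open>\<Phi>\<close> is onto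
  (\<open>Phi_YD_iso\<close>). Each of the three hypotheses forces this.

  (a) If \<open>\<theta>\<close> fixed an element \<open>c \<noteq> 0\<close>, then \<open>\<theta> - 1\<close> would not be injective, hence not surjective, and
  a nontrivial character of its cokernel would span a second \<open>\<theta>\<close>-stable one-dimensional ideal besides
  that of the trivial character. So there is no room for nonzero values of \<open>s\<close>.

  (b) Eigenvalues satisfy \<open>l ^ n = 1\<close> for the order \<open>n\<close> of \<open>\<theta>\<close>, so the order of \<open>s l\<close> divides both \<open>n\<close>
  and the order of the group.

  (c) Group algebras are cocommutative. Transporting the formula for \<open>\<Delta> (F\<^sub>L b)\<close> back along the inverse
  of \<open>F\<^sub>L\<close>, the tensor \<open>\<Sum>l. b \<cdot> s' l \<otimes> E l b\<close> is symmetric for every group element \<open>b\<close>, where \<open>s'\<close> is the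
  inverse of the analogue of \<open>s\<close> for the automorphism inverse to \<open>F\<close> (\<open>twisted_comult_symmetric\<close>).
  If \<open>s\<close> were nontrivial and \<open>\<theta>\<close> had prime order \<open>p\<close>, then \<open>s'\<close> would be injective on eigenvalues, and
  the coefficient of \<open>b \<otimes> \<theta> b\<close> would be that of \<open>E 1 b\<close> at \<open>\<theta> b\<close>, which is not zero. By symmetry
  \<open>\<theta> b \<otimes> b\<close> occurs as well, which means that \<open>\<theta> b - b\<close> is a value of \<open>s'\<close> and therefore killed by \<open>p\<close>.
  Now the kernel of \<open>\<theta> - 1\<close> contains values of \<open>s'\<close> of order \<open>p\<close>, and its image, which is nonzero,
  contains elements of order \<open>p\<close> too. So \<open>p\<^sup>2\<close> divides the order of the group.
\<close>

section \<open>Linear maps between free vector spaces\<close>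

interpretation klin: vector_space_pair scale scale
  by unfold_locales

abbreviation coord :: "('x \<Rightarrow>\<^sub>0 'k::zero) \<Rightarrow> 'x \<Rightarrow> 'k" where
  "coord \<equiv> Poly_Mapping.lookup"

lemma klinearI:
  assumes "\<And>u v. S (u + v) = S u + S v" "\<And>c u. S (scale c u) = scale c (S u)"
  shows "klinear S"
  unfolding Vector_Spaces.linear_iff by (intro conjI fm.vector_space_axioms allI assms)

lemma coord_delta: "coord (delta x) y = (if x = y then 1 else 0)"
  by (simp add: lookup_single)

lemma coord_sum: "coord (sum f A) x = (\<Sum>a\<in>A. coord (f a) x)"
  by (simp add: lookup_sum)

lemma coord_eqI: "(\<And>x. coord u x = coord v x) \<Longrightarrow> u = v"
  by (rule poly_mapping_eqI)

lemma lin_ext_superset: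
  assumes "finite A" "Poly_Mapping.keys v \<subseteq> A"
  shows "lin_ext f v = (\<Sum>x\<in>A. scale (coord v x) (f x))"
  unfolding lin_ext_def using assms
  by (intro sum.mono_neutral_left) (auto simp: in_keys_iff)

lemma klinear_lin_ext: "klinear (lin_ext f)" for f :: "'x \<Rightarrow> ('y \<Rightarrow>\<^sub>0 'k::field)"
proof (rule klinearI)
  fix u v :: "'x \<Rightarrow>\<^sub>0 'k"
  let ?A = "Poly_Mapping.keys u \<union> Poly_Mapping.keys v"
  have "Poly_Mapping.keys (u + v) \<subseteq> ?A" by (rule keys_add)
  then show "lin_ext f (u + v) = lin_ext f u + lin_ext f v"
    by (simp add: lin_ext_superset[of ?A] lookup_add fm.scale_left_distrib sum.distrib)
next
  fix c and u :: "'x \<Rightarrow>\<^sub>0 'k"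
  have "Poly_Mapping.keys (scale c u) \<subseteq> Poly_Mapping.keys u" by (auto simp: in_keys_iff)
  then show "lin_ext f (scale c u) = scale c (lin_ext f u)"
    by (simp add: lin_ext_superset[of "Poly_Mapping.keys u"] fm.scale_sum_right)
qed

lemma lin_ext_delta [simp]: "lin_ext f (delta x) = f x"
  by (simp add: lin_ext_def)

lemma lin_ext_delta_id: "lin_ext delta v = v"
  by (rule coord_eqI)
    (auto simp: lin_ext_def coord_sum coord_delta if_distrib in_keys_iff cong: if_cong)

lemma klinear_eq_lin_ext:
  assumes "klinear S" shows "S v = lin_ext (\<lambda>x. S (delta x)) v"
proof -
  have "S (lin_ext delta v) = lin_ext (\<lambda>x. S (delta x)) v"
    by (simp add: lin_ext_def klin.linear_sum[OF assms] klin.linear_scale[OF assms])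
  then show ?thesis by (simp add: lin_ext_delta_id)
qed

lemma klinear_eqI:
  assumes "klinear S" "klinear S'" "\<And>x. S (delta x) = S' (delta x)"
  shows "S v = S' v"
  using assms(3) by (simp add: klinear_eq_lin_ext[OF assms(1), of v] klinear_eq_lin_ext[OF assms(2), of v])

text \<open>
  Bilinear maps that agree on pairs of basis vectors are equal. This is how identities in tensor products
  are reduced to group elements.
\<close>

lemma klinear_eq2I:
  assumes "\<And>v. klinear (\<lambda>u. S u v)" "\<And>v. klinear (\<lambda>u. S' u v)"
    and "\<And>u. klinear (S u)" "\<And>u. klinear (S' u)"
    and "\<And>x y. S (delta x) (delta y) = S' (delta x) (delta y)"
  shows "S u v = S' u v"
proof (rule klinear_eqI[OF assms(1,2)])
  show "S (delta x) v = S' (delta x) v" for x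
    by (rule klinear_eqI[OF assms(3,4,5)])
qed

lemma coord_lin_ext_finite:
  fixes v :: "'x::finite \<Rightarrow>\<^sub>0 'k::field"
  shows "coord (lin_ext f v) y = (\<Sum>x\<in>UNIV. coord v x * coord (f x) y)"
  by (simp add: lin_ext_superset[of UNIV] coord_sum)

lemma klinear_coord_finite:
  fixes S :: "('x::finite \<Rightarrow>\<^sub>0 'k::field) \<Rightarrow> ('y \<Rightarrow>\<^sub>0 'k)"
  assumes "klinear S"
  shows "coord (S v) y = (\<Sum>x\<in>UNIV. coord v x * coord (S (delta x)) y)"
  by (subst klinear_eq_lin_ext[OF assms]) (rule coord_lin_ext_finite)

named_theorems klinear_intros

lemma klinear_ident [klinear_intros]: "klinear (\<lambda>v. v)"
  by (rule klinearI) auto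

lemma klinear_id [klinear_intros]: "klinear id"
  by (rule klinearI) auto

lemma klinear_o [klinear_intros]: "klinear S \<Longrightarrow> klinear S' \<Longrightarrow> klinear (S \<circ> S')"
  by (rule Vector_Spaces.linear_compose)

lemma klinear_compose: "klinear S \<Longrightarrow> klinear S' \<Longrightarrow> klinear (\<lambda>v. S (S' v))"
  using klinear_o[of S S'] by (simp add: o_def)

lemma klinear_sum [klinear_intros]:
  "(\<And>a. a \<in> A \<Longrightarrow> klinear (S a)) \<Longrightarrow> klinear (\<lambda>v. \<Sum>a\<in>A. S a v)"
  by (rule klin.linear_compose_sum) auto

lemma klinear_lin_ext_app [klinear_intros]:
  "klinear S \<Longrightarrow> klinear (\<lambda>v. lin_ext f (S v))"
  by (rule klinear_compose[OF klinear_lin_ext])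

lemma klinear_lin_ext_fun:
  assumes "\<And>x. klinear (\<lambda>v. f v x)"
  shows "klinear (\<lambda>v. lin_ext (f v) w)"
  unfolding lin_ext_def
  by (intro klinear_sum klin.linear_compose_scale_right assms)

lemma scale_mult_left: "scale c u * v = scale c (u * v)" for u :: "'c::monoid_add \<Rightarrow>\<^sub>0 'k::field"
  by (simp add: scale_def mult_map_scale_conv_mult mult.assoc)

text \<open>
  Scalars embed into the group algebra as multiples of the unit, so scalar multiplication is
  multiplication by a central element.
\<close>

lemma single_central:
  "u * Poly_Mapping.single 0 c = Poly_Mapping.single 0 c * u"
  for u :: "'c::monoid_add \<Rightarrow>\<^sub>0 'k::field"
proof -
  have u: "u = (\<Sum>x\<in>Poly_Mapping.keys u. Poly_Mapping.single x (coord u x))"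
    by (rule coord_eqI) (auto simp: coord_sum lookup_single when_def in_keys_iff cong: if_cong)
  show ?thesis
    by (subst (1 2) u) (simp add: sum_distrib_left sum_distrib_right mult_single mult.commute)
qed

lemma scale_mult_right: "u * scale c v = scale c (u * v)" for u :: "'c::monoid_add \<Rightarrow>\<^sub>0 'k::field"
  unfolding scale_def mult_map_scale_conv_mult
  by (simp add: single_central mult.assoc flip: mult.assoc[of u])

lemma klinear_mult_left [klinear_intros]:
  "klinear S \<Longrightarrow> klinear (\<lambda>v. S v * u)" for u :: "'c::monoid_add \<Rightarrow>\<^sub>0 'k::field"
  by (rule klinearI)
    (simp_all add: klin.linear_add klin.linear_scale scale_mult_left distrib_right)

lemma klinear_mult_right [klinear_intros]:
  "klinear S \<Longrightarrow> klinear (\<lambda>v. u * S v)" for u :: "'c::monoid_add \<Rightarrow>\<^sub>0 'k::field"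
  by (rule klinearI)
    (simp_all add: klin.linear_add klin.linear_scale scale_mult_right distrib_left)

lemma klinear_scale [klinear_intros]: "klinear S \<Longrightarrow> klinear (\<lambda>v. scale c (S v))"
  by (rule klin.linear_compose_scale_right)

lemma delta_mult [simp]: "delta x * delta y = delta (x + y)"
  by (simp add: mult_single)

lemma coord_tensor [simp]: "coord (tensor u v) (x, y) = coord u x * coord v y"
proof -
  have inner: "coord (lin_ext (\<lambda>y. delta (x', y)) v) (x, y) = (if x' = x then coord v y else 0)" for x'
    by (auto simp: lin_ext_def coord_sum coord_delta if_distrib in_keys_iff cong: if_cong)
  show ?thesis
    by (auto simp: tensor_def lin_ext_def[of _ u] coord_sum inner if_distrib in_keys_iff cong: if_cong)
qed

lemma tensor_delta [simp]: "tensor (delta x) (delta y) = delta (x, y)"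
  by (simp add: tensor_def)

lemma klinear_tensor_left [klinear_intros]: "klinear S \<Longrightarrow> klinear (\<lambda>v. tensor (S v) u)"
  by (rule klinearI; rule coord_eqI)
    (auto simp: klin.linear_add klin.linear_scale lookup_add distrib_right)

lemma klinear_tensor_right [klinear_intros]: "klinear S \<Longrightarrow> klinear (\<lambda>v. tensor u (S v))"
  by (rule klinearI; rule coord_eqI)
    (auto simp: klin.linear_add klin.linear_scale lookup_add distrib_left)

lemma klinear_tensor_map [klinear_intros]: "klinear R \<Longrightarrow> klinear (\<lambda>v. tensor_map S T (R v))"
  unfolding tensor_map_def by (intro klinear_intros)

lemma tensor_map_delta [simp]: "tensor_map S T (delta (x, y)) = tensor (S (delta x)) (T (delta y))"
  by (simp add: tensor_map_def)

lemma tensor_map_tensor: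
  assumes "klinear S" "klinear T"
  shows "tensor_map S T (tensor u v) = tensor (S u) (T v)"
  by (rule klinear_eq2I[of "\<lambda>u v. tensor_map S T (tensor u v)"])
    (auto intro!: klinear_intros assms)

lemma tensor_map_comp:
  assumes "klinear S" "klinear T" "klinear S'" "klinear T'"
  shows "tensor_map S T (tensor_map S' T' v) = tensor_map (S \<circ> S') (T \<circ> T') v"
  by (rule klinear_eqI[of "\<lambda>v. tensor_map S T (tensor_map S' T' v)"])
    (auto intro!: klinear_intros assms simp: tensor_map_tensor assms(1,2))

lemma tensor_map_id: "tensor_map id id v = v"
  by (rule klinear_eqI[of "\<lambda>v. tensor_map id id v"]) (auto intro!: klinear_intros)

lemma klinear_sweedler [klinear_intros]: "klinear R \<Longrightarrow> klinear (\<lambda>v. sweedler E (R v))"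
  unfolding sweedler_def by (intro klinear_intros)

lemma sweedler_delta [simp]: "sweedler E (delta (x, y)) = E (delta x) (delta y)"
  by (simp add: sweedler_def)

lemma sweedler_tensor:
  assumes "\<And>u. klinear (E u)" "\<And>v. klinear (\<lambda>u. E u v)"
  shows "sweedler E (tensor u v) = E u v"
  by (rule klinear_eq2I[of "\<lambda>u v. sweedler E (tensor u v)" E])
    (auto intro!: klinear_intros assms)

lemma klinear_galg_comult [klinear_intros]: "klinear R \<Longrightarrow> klinear (\<lambda>v. galg_comult (R v))"
  unfolding galg_comult_def by (intro klinear_intros)

lemma galg_comult_delta [simp]: "galg_comult (delta x) = delta (x, x)"
  by (simp add: galg_comult_def)

lemma galg_counit_superset:
  assumes "finite A" "Poly_Mapping.keys v \<subseteq> A"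
  shows "galg_counit v = (\<Sum>x\<in>A. coord v x)"
  unfolding galg_counit_def using assms
  by (intro sum.mono_neutral_left) (auto simp: in_keys_iff)

lemma galg_counit_add: "galg_counit (u + v) = galg_counit u + galg_counit v"
proof -
  have "Poly_Mapping.keys (u + v) \<subseteq> Poly_Mapping.keys u \<union> Poly_Mapping.keys v" by (rule keys_add)
  then show ?thesis
    by (simp add: galg_counit_superset[of "Poly_Mapping.keys u \<union> Poly_Mapping.keys v"]
        lookup_add sum.distrib)
qed

lemma galg_counit_scale: "galg_counit (scale c v) = c * galg_counit v"
proof -
  have "Poly_Mapping.keys (scale c v) \<subseteq> Poly_Mapping.keys v" by (auto simp: in_keys_iff)
  then show ?thesis
    by (simp add: galg_counit_superset[of "Poly_Mapping.keys v"] sum_distrib_left)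
qed

lemma galg_counit_delta [simp]: "galg_counit (delta x) = 1"
  by (simp add: galg_counit_def)

text \<open>The counit is scalar valued; multiplying a vector by it turns it into a linear map of free
  spaces.\<close>

lemma klinear_counit_scale [klinear_intros]:
  "klinear R \<Longrightarrow> klinear (\<lambda>v. scale (galg_counit (R v)) w)"
  by (rule klinearI)
    (auto simp: klin.linear_add klin.linear_scale galg_counit_add galg_counit_scale
      fm.scale_left_distrib)

lemma galg_counit_eqI:
  assumes "klinear S" "klinear S'"
    and "\<And>x. galg_counit (S (delta x)) = galg_counit (S' (delta x))"
  shows "galg_counit (S v) = galg_counit (S' v)"
proof -
  \<comment> \<open>The field is the free space on a one-element basis, so that the counit becomes a map of free
    spaces and extensionality on basis vectors applies.\<close>
  let ?e = "\<lambda>u. scale (galg_counit u) (delta ())"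
  have "?e (S v) = ?e (S' v)"
    by (rule klinear_eqI[of "\<lambda>v. ?e (S v)" "\<lambda>v. ?e (S' v)"])
      (auto intro!: klinear_intros assms(1,2) simp: assms(3))
  from arg_cong[OF this, of "\<lambda>u. coord u ()"] show ?thesis by (simp add: coord_delta)
qed

section \<open>Eigenprojections of a diagonalizable operator\<close>

definition diagonalizable :: "(('x \<Rightarrow>\<^sub>0 'k::field) \<Rightarrow> ('x \<Rightarrow>\<^sub>0 'k)) \<Rightarrow> bool" where
  "diagonalizable T \<longleftrightarrow> klinear T \<and> fm.span (\<Union>l. eigenspace T l) = UNIV"

definition eigenvalues :: "(('x \<Rightarrow>\<^sub>0 'k::field) \<Rightarrow> ('x \<Rightarrow>\<^sub>0 'k)) \<Rightarrow> 'k set" where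
  "eigenvalues T = {l. eigenspace T l \<noteq> {0}}"

text \<open>
  Chosen by its action on eigenvectors; for diagonalizable operators this determines it.
\<close>

definition eigenproj ::
  "(('x \<Rightarrow>\<^sub>0 'k::field) \<Rightarrow> ('x \<Rightarrow>\<^sub>0 'k)) \<Rightarrow> 'k \<Rightarrow> ('x \<Rightarrow>\<^sub>0 'k) \<Rightarrow> ('x \<Rightarrow>\<^sub>0 'k)" where
  "eigenproj T l = (SOME E. klinear E \<and> (\<forall>m. \<forall>v\<in>eigenspace T m. E v = (if m = l then v else 0)))"

lemma zero_in_eigenspace: "klinear T \<Longrightarrow> 0 \<in> eigenspace T l"
  by (simp add: eigenspace_def klin.linear_0)

lemma eigenspace_eqI:
  assumes "diagonalizable T" "klinear S" "klinear S'"
    and "\<And>l v. v \<in> eigenspace T l \<Longrightarrow> S v = S' v"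
  shows "S v = S' v"
proof (rule klin.linear_eq_on[OF assms(2,3)])
  show "v \<in> fm.span (\<Union>l. eigenspace T l)" using assms(1) by (simp add: diagonalizable_def)
qed (use assms(4) in auto)

lemma finite_type_span: "fm.span (range delta) = (UNIV :: ('x::finite \<Rightarrow>\<^sub>0 'k::field) set)"
proof -
  have "v \<in> fm.span (range delta)" for v :: "'x \<Rightarrow>\<^sub>0 'k"
    by (subst lin_ext_delta_id[symmetric], unfold lin_ext_def)
      (intro fm.span_sum fm.span_scale fm.span_base rangeI)
  then show ?thesis by auto
qed

text \<open>
  Take a basis of eigenvectors and project onto the basis vectors with eigenvalue \<open>l\<close>. The resulting maps
  commute with \<open>T\<close>, which is why they have the right value on every eigenvector and not only on those in
  the basis: a vector of eigenvalue \<open>m\<close> has an image of eigenvalue both \<open>m\<close> and \<open>l\<close>.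
\<close>

lemma diagonalizable_projections:
  fixes T :: "('x::finite \<Rightarrow>\<^sub>0 'k::field) \<Rightarrow> ('x \<Rightarrow>\<^sub>0 'k)"
  assumes "diagonalizable T"
  obtains P where "\<And>l. klinear (P l)"
    "\<And>l m v. v \<in> eigenspace T m \<Longrightarrow> P l v = (if m = l then v else 0)"
    "finite (eigenvalues T)"
proof -
  have T: "klinear T" using assms by (simp add: diagonalizable_def)
  obtain B where B: "B \<subseteq> (\<Union>l. eigenspace T l)" "fm.independent B"
      "(\<Union>l. eigenspace T l) \<subseteq> fm.span B"
    using fm.maximal_independent_subset by blast
  have spanB: "fm.span B = UNIV"
    using assms fm.span_mono[OF B(3)] by (auto simp: diagonalizable_def fm.span_span)
  have finB: "finite B"
    using fm.independent_span_bound[of "range delta" B] B(2) by (simp add: finite_type_span)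
  define ev where "ev v = (SOME l. v \<in> eigenspace T l)" for v
  have ev: "T v = scale (ev v) v" if "v \<in> B" for v
  proof -
    have "\<exists>l. v \<in> eigenspace T l" using that B(1) by auto
    then have "v \<in> eigenspace T (ev v)" unfolding ev_def by (rule someI_ex)
    then show ?thesis by (simp add: eigenspace_def)
  qed
  have "\<forall>l. \<exists>P. klinear P \<and> (\<forall>v\<in>B. P v = (if ev v = l then v else 0))"
    by (intro allI klin.linear_independent_extend B(2))
  then obtain P where P: "\<And>l. klinear (P l)"
    and PB: "\<And>l v. v \<in> B \<Longrightarrow> P l v = (if ev v = l then v else 0)"
    by metis
  have eqB: "S v = S' v" if "klinear S" "klinear S'" "\<And>v. v \<in> B \<Longrightarrow> S v = S' v"
    for S S' :: "('x \<Rightarrow>\<^sub>0 'k) \<Rightarrow> ('x \<Rightarrow>\<^sub>0 'k)" and v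
    by (rule klin.linear_eq_on[OF that(1,2)]) (use spanB that(3) in auto)
  have TP: "T (P l v) = scale l (P l v)" for l v
    by (rule eqB[of "\<lambda>v. T (P l v)"])
      (auto intro!: klinear_intros klinear_compose[OF T] P simp: PB ev klin.linear_0[OF T])
  have PT: "P l (T v) = T (P l v)" for l v
    by (rule eqB[of "\<lambda>v. P l (T v)"])
      (auto intro!: klinear_compose[OF T] klinear_compose[OF P] T P
        simp: PB ev klin.linear_0[OF T] klin.linear_scale[OF P])
  have total: "(\<Sum>l\<in>ev ` B. P l v) = v" for v
    by (rule eqB[of "\<lambda>v. \<Sum>l\<in>ev ` B. P l v"])
      (auto intro!: klinear_intros P simp: PB finB)
  have P0: "P l v = 0" if "v \<in> eigenspace T m" "m \<noteq> l" for l m v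
  proof -
    have "scale m (P l v) = scale l (P l v)"
      using PT[of l v] TP[of l v] that(1) by (simp add: eigenspace_def klin.linear_scale[OF P])
    then show ?thesis using that(2) by simp
  qed
  have P1: "P l v = v" if "v \<in> eigenspace T l" for l v
  proof -
    have "v = (\<Sum>m\<in>ev ` B. P m v)" by (simp add: total)
    also have "\<dots> = (\<Sum>m\<in>ev ` B. if m = l then P l v else 0)"
      by (intro sum.cong refl) (auto simp: P0[OF that])
    finally have *: "v = (if l \<in> ev ` B then P l v else 0)" by (simp add: finB)
    show ?thesis
    proof (cases "l \<in> ev ` B")
      case False
      then have "v = 0" using * by simp
      then show ?thesis by (simp add: klin.linear_0[OF P])
    qed (use * in simp)
  qed
  have "eigenvalues T \<subseteq> ev ` B"
  proof
    fix l assume "l \<in> eigenvalues T"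
    then obtain v where v: "v \<in> eigenspace T l" "v \<noteq> 0"
      using zero_in_eigenspace[OF T] by (auto simp: eigenvalues_def)
    show "l \<in> ev ` B"
    proof (rule ccontr)
      assume "l \<notin> ev ` B"
      then have "(\<Sum>m\<in>ev ` B. P m v) = 0" by (intro sum.neutral) (use P0[OF v(1)] in auto)
      then show False using total v(2) by simp
    qed
  qed
  then have "finite (eigenvalues T)" using finB finite_subset by blast
  then show ?thesis using P P0 P1 by (intro that[of P]) auto
qed

lemma
  fixes T :: "('x::finite \<Rightarrow>\<^sub>0 'k::field) \<Rightarrow> ('x \<Rightarrow>\<^sub>0 'k)"
  assumes "diagonalizable T"
  shows klinear_eigenproj: "klinear (eigenproj T l)"
    and eigenproj_eigenspace:
      "v \<in> eigenspace T m \<Longrightarrow> eigenproj T l v = (if m = l then v else 0)"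
proof -
  obtain P where P: "\<And>l. klinear (P l)"
    "\<And>l m v. v \<in> eigenspace T m \<Longrightarrow> P l v = (if m = l then v else 0)"
    using diagonalizable_projections[OF assms] by metis
  have "klinear (eigenproj T l) \<and>
    (\<forall>m. \<forall>v\<in>eigenspace T m. eigenproj T l v = (if m = l then v else 0))"
    unfolding eigenproj_def by (rule someI[of _ "P l"]) (use P in blast)
  then show "klinear (eigenproj T l)"
    "v \<in> eigenspace T m \<Longrightarrow> eigenproj T l v = (if m = l then v else 0)" by blast+
qed

lemma finite_eigenvalues:
  fixes T :: "('x::finite \<Rightarrow>\<^sub>0 'k::field) \<Rightarrow> ('x \<Rightarrow>\<^sub>0 'k)"
  assumes "diagonalizable T"
  shows "finite (eigenvalues T)"
  using diagonalizable_projections[OF assms] by metis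

lemma sum_eigenproj:
  fixes T :: "('x::finite \<Rightarrow>\<^sub>0 'k::field) \<Rightarrow> ('x \<Rightarrow>\<^sub>0 'k)"
  assumes "diagonalizable T"
  shows "(\<Sum>l\<in>eigenvalues T. eigenproj T l v) = v"
proof (rule eigenspace_eqI[OF assms, of "\<lambda>v. \<Sum>l\<in>eigenvalues T. eigenproj T l v"])
  fix m v assume v: "v \<in> eigenspace T m"
  show "(\<Sum>l\<in>eigenvalues T. eigenproj T l v) = v"
  proof (cases "m \<in> eigenvalues T")
    case True
    then show ?thesis
      by (simp add: eigenproj_eigenspace[OF assms v] finite_eigenvalues[OF assms])
  next
    case False
    then have "v = 0" using v by (auto simp: eigenvalues_def)
    then show ?thesis by (simp add: klin.linear_0 klinear_eigenproj[OF assms])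
  qed
qed (auto intro!: klinear_intros klinear_eigenproj assms)

lemma eigenproj_in_eigenspace:
  fixes T :: "('x::finite \<Rightarrow>\<^sub>0 'k::field) \<Rightarrow> ('x \<Rightarrow>\<^sub>0 'k)"
  assumes "diagonalizable T"
  shows "T (eigenproj T l v) = scale l (eigenproj T l v)"
proof -
  have T: "klinear T" using assms by (simp add: diagonalizable_def)
  show ?thesis
    by (rule eigenspace_eqI[OF assms, of "\<lambda>v. T (eigenproj T l v)"])
      (auto intro!: klinear_intros klinear_compose[OF T] klinear_eigenproj assms
        simp: eigenproj_eigenspace[OF assms] klin.linear_0[OF T], simp add: eigenspace_def)
qed

section \<open>Structure maps of the biproduct\<close>

locale abelian_biproduct = biproduct_data \<mu> \<theta> emb V
  for \<mu> :: "'g::group_add \<Rightarrow> 'c::{ab_group_add, finite} \<Rightarrow> 'c"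
    and \<theta> :: "'c \<Rightarrow> 'c"
    and emb :: "'k::field \<Rightarrow> 'g"
    and V :: "'g set"
begin

abbreviation T :: "('c \<Rightarrow>\<^sub>0 'k) \<Rightarrow> ('c \<Rightarrow>\<^sub>0 'k)" where "T \<equiv> lin_of \<theta>"
abbreviation Ev :: "'k set" where "Ev \<equiv> eigenvalues T"
abbreviation E :: "'k \<Rightarrow> ('c \<Rightarrow>\<^sub>0 'k) \<Rightarrow> ('c \<Rightarrow>\<^sub>0 'k)" where "E \<equiv> eigenproj T"
abbreviation U :: "'k set" where "U \<equiv> eigenvalue_group T"

lemma klinear_lin_of: "klinear R \<Longrightarrow> klinear (\<lambda>v. lin_of f (R v))"
  unfolding lin_of_def by (intro klinear_intros)

lemma diag: "diagonalizable T"
  unfolding diagonalizable_def using \<theta>_diagonalizable klinear_lin_of[OF klinear_ident, of \<theta>] by simp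

lemma lin_of_delta [simp]: "lin_of f (delta x) = delta (f x)"
  by (simp add: lin_of_def)

lemma
  shows \<theta>_add: "\<theta> (x + y) = \<theta> x + \<theta> y" and bij_\<theta>: "bij \<theta>"
  using \<theta>_auto by (auto simp: AutoGroup_def auto_def hom_def Bij_def grp_def)

lemma
  shows \<mu>_arg_add: "\<mu> g (x + y) = \<mu> g x + \<mu> g y"
    and \<mu>_add: "\<mu> (g + h) x = \<mu> g (\<mu> h x)"
proof -
  have \<mu>: "\<mu> g \<in> auto grp" for g
    using \<mu>_hom by (auto simp: AutoGroup_def hom_def grp_def)
  then show "\<mu> g (x + y) = \<mu> g x + \<mu> g y"
    by (force simp: auto_def hom_def grp_def)
  have Bij: "\<mu> g \<in> Bij UNIV" for g
    using \<mu>[of g] by (simp add: auto_def grp_def)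
  have "\<mu> (g + h) = compose UNIV (\<mu> g) (\<mu> h)"
    using \<mu>_hom Bij by (simp add: AutoGroup_def hom_def grp_def BijGroup_def)
  then show "\<mu> (g + h) x = \<mu> g (\<mu> h x)" by (simp add: compose_def)
qed

lemma \<theta>_zero [simp]: "\<theta> 0 = 0"
  using \<theta>_add[of 0 0] by simp

lemma \<mu>_arg_zero [simp]: "\<mu> g 0 = 0"
  using \<mu>_arg_add[of g 0 0] by simp

lemma Ev_subset_U: "Ev \<subseteq> U"
  by (auto simp: eigenvalues_def eigenvalue_group_def intro: generate.incl)

lemma one_in_U: "1 \<in> U"
  using generate.one[of units_group]
  by (simp add: eigenvalue_group_def units_group_def mult_of_def ring_of_type_algebra_def)

lemma mult_in_U: "l \<in> U \<Longrightarrow> m \<in> U \<Longrightarrow> l * m \<in> U"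
  using generate.eng[of _ units_group]
  by (force simp add: eigenvalue_group_def units_group_def mult_of_def ring_of_type_algebra_def)

lemma emb_mult: "l \<in> U \<Longrightarrow> m \<in> U \<Longrightarrow> emb (l * m) = emb l + emb m"
  using emb_iso
  by (auto simp: iso_def hom_def units_group_def mult_of_def ring_of_type_algebra_def grp_def)

lemma emb_inj: "inj_on emb U"
  using emb_iso by (auto simp: iso_def bij_betw_def)

lemma emb_in_V: "l \<in> U \<Longrightarrow> emb l \<in> V"
  using emb_iso by (auto simp: iso_def hom_def)

lemma emb_one [simp]: "emb 1 = 0"
  using emb_mult[OF one_in_U one_in_U] by (metis add.right_neutral add_left_cancel mult_1)

lemma \<mu>_emb: "l \<in> U \<Longrightarrow> \<mu> (emb l) x = x"
  using V_central emb_in_V by (force simp: kernel_def AutoGroup_def BijGroup_def grp_def)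

lemma coord_T: "coord (T v) (\<theta> x) = coord v x"
proof -
  have "coord (T v) (\<theta> x) = (\<Sum>y\<in>UNIV. coord v y * coord (delta (\<theta> y)) (\<theta> x))"
    unfolding lin_of_def by (rule coord_lin_ext_finite)
  also have "\<dots> = (\<Sum>y\<in>UNIV. if y = x then coord v x else 0)"
    using bij_\<theta> by (intro sum.cong refl) (auto simp: coord_delta bij_def inj_eq)
  finally show ?thesis by simp
qed

text \<open>
  Summing coordinates over a \<open>\<theta>\<close>-stable set is a functional invariant under \<open>T\<close>, and such a functional
  vanishes on every eigenspace except that of eigenvalue \<open>1\<close>. For the whole group it is the counit; for
  an orbit it shows that the invariant part of a group element is spread over its whole orbit.
\<close>

lemma invariant_functional_eigenproj:
  assumes "\<theta> ` S = S"
  shows "(\<Sum>x\<in>S. coord (E l v) x) = (if l = 1 then \<Sum>x\<in>S. coord v x else 0)"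
proof -
  let ?\<phi> = "\<lambda>v. \<Sum>x\<in>S. coord v x"
  have inv: "?\<phi> (T v) = ?\<phi> v" for v
  proof -
    have "?\<phi> (T v) = (\<Sum>x\<in>\<theta> ` S. coord (T v) x)" by (simp add: assms)
    also have "\<dots> = ?\<phi> v"
      using bij_\<theta> by (subst sum.reindex) (auto simp: bij_def coord_T intro: inj_on_subset)
    finally show ?thesis .
  qed
  have other: "?\<phi> (E m v) = 0" if "m \<noteq> 1" for m
  proof -
    have "?\<phi> (E m v) = m * ?\<phi> (E m v)"
      using inv[of "E m v"] by (simp add: eigenproj_in_eigenspace[OF diag] sum_distrib_left)
    then show ?thesis using that by simp
  qed
  have "?\<phi> v = ?\<phi> (\<Sum>m\<in>Ev. E m v)" by (simp add: sum_eigenproj[OF diag])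
  also have "\<dots> = (\<Sum>m\<in>Ev. ?\<phi> (E m v))" by (simp add: coord_sum) (rule sum.swap)
  also have "\<dots> = (\<Sum>m\<in>Ev. if m = 1 then ?\<phi> (E 1 v) else 0)"
    by (intro sum.cong refl) (auto simp: other)
  also have "\<dots> = (if 1 \<in> Ev then ?\<phi> (E 1 v) else 0)"
    by (simp add: finite_eigenvalues[OF diag])
  also have "\<dots> = ?\<phi> (E 1 v)"
  proof (cases "1 \<in> Ev")
    case False
    have "E 1 v \<in> eigenspace T 1"
      using eigenproj_in_eigenspace[OF diag] by (simp add: eigenspace_def)
    then have "E 1 v = 0" using False by (simp add: eigenvalues_def)
    then show ?thesis by simp
  qed simp
  finally show ?thesis using other by auto
qed

lemma galg_counit_UNIV: "galg_counit v = (\<Sum>x\<in>UNIV. coord v x)" for v :: "'c \<Rightarrow>\<^sub>0 'k"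
  by (rule galg_counit_superset) auto

lemma galg_counit_one [simp]: "galg_counit 1 = 1"
  using galg_counit_delta[of 0] by simp

lemma galg_counit_zero [simp]: "galg_counit 0 = 0"
  by (simp add: galg_counit_def)

lemma counit_eigenproj: "galg_counit (E l v) = (if l = 1 then galg_counit v else 0)"
  using invariant_functional_eigenproj[of UNIV l v] bij_\<theta>
  by (simp add: galg_counit_UNIV bij_def)

lemma one_in_Ev: "1 \<in> Ev"
proof (rule ccontr)
  assume "1 \<notin> Ev"
  moreover have "E 1 (delta 0) \<in> eigenspace T 1"
    using eigenproj_in_eigenspace[OF diag] by (simp add: eigenspace_def)
  ultimately have "E 1 (delta 0) = 0" by (simp add: eigenvalues_def)
  then show False using counit_eigenproj[of 1 "delta 0"] by (simp add: galg_counit_zero)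
qed

lemma klinear_E: "klinear R \<Longrightarrow> klinear (\<lambda>v. E l (R v))"
  by (rule klinear_compose[OF klinear_eigenproj[OF diag]])

text \<open>
  The coaction is defined by its values on eigenvectors, so it is the sum of its components along the
  eigenprojections. All later computations with it use this form.
\<close>

lemma coact_eq: "coact \<theta> emb v = (\<Sum>l\<in>Ev. tensor (delta (emb l)) (E l v))"
proof -
  let ?\<rho> = "\<lambda>v. \<Sum>l\<in>Ev. tensor (delta (emb l)) (E l v)"
  have lin: "klinear ?\<rho>" by (intro klinear_intros klinear_E)
  have eig: "?\<rho> b = tensor (delta (emb l)) b" if b: "b \<in> eigenspace T l" for l b
  proof (cases "l \<in> Ev")
    case True
    have "?\<rho> b = (\<Sum>m\<in>Ev. if m = l then tensor (delta (emb l)) b else 0)"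
      by (intro sum.cong refl) (auto simp: eigenproj_eigenspace[OF diag b] klin.linear_0[OF klinear_tensor_right[OF klinear_ident]])
    then show ?thesis using True by (simp add: finite_eigenvalues[OF diag])
  next
    case False
    then have "b = 0" using b by (auto simp: eigenvalues_def)
    then show ?thesis
      by (simp add: klin.linear_0[OF lin] klin.linear_0[OF klinear_tensor_right[OF klinear_ident]])
  qed
  have "coact \<theta> emb = ?\<rho>"
    unfolding coact_def
  proof (rule the_equality)
    show "klinear ?\<rho> \<and> (\<forall>l. \<forall>b\<in>eigenspace T l. ?\<rho> b = tensor (delta (emb l)) b)"
      using lin eig by blast
  next
    fix \<rho> :: "('c \<Rightarrow>\<^sub>0 'k) \<Rightarrow> ('g \<times> 'c \<Rightarrow>\<^sub>0 'k)"
    assume \<rho>: "klinear \<rho> \<and> (\<forall>l. \<forall>b\<in>eigenspace T l. \<rho> b = tensor (delta (emb l)) b)"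
    show "\<rho> = ?\<rho>"
      by (rule ext, rule eigenspace_eqI[OF diag]) (use \<rho> lin eig in auto)
  qed
  then show ?thesis by simp
qed

lemma act_delta: "act \<mu> (delta g) b = lin_of (\<mu> g) b"
  by (simp add: act_def)

lemma klinear_act [klinear_intros]: "klinear R \<Longrightarrow> klinear (\<lambda>v. act \<mu> (R v) b)"
  unfolding act_def by (intro klinear_intros)

lemma klinear_sweedler_fun:
  assumes "\<And>x y. klinear (\<lambda>v. F v (delta x) (delta y))"
  shows "klinear (\<lambda>v. sweedler (F v) w)"
  unfolding sweedler_def
  by (intro klinear_lin_ext_fun) (use assms in \<open>auto split: prod.split\<close>)

lemma klinear_bip_mult_left: "klinear R \<Longrightarrow> klinear (\<lambda>u. bip_mult \<mu> (R u) v)"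
  unfolding bip_mult_def by (intro klinear_intros)

lemma klinear_bip_mult_right: "klinear R \<Longrightarrow> klinear (\<lambda>v. bip_mult \<mu> u (R v))"
  unfolding bip_mult_def by (intro klinear_sweedler_fun klinear_intros)

lemma bip_mult_delta:
  "bip_mult \<mu> (delta (b, g)) (delta (b', g')) = (delta (b + \<mu> g b', g + g') :: _ \<Rightarrow>\<^sub>0 'k)"
  by (simp add: bip_mult_def act_delta)

lemma bip_mult_tensor:
  "bip_mult \<mu> (tensor b (delta g)) (tensor b' (delta g')) =
    (tensor (b * lin_of (\<mu> g) b') (delta (g + g')) :: _ \<Rightarrow>\<^sub>0 'k)"
  by (rule klinear_eq2I[of
        "\<lambda>b b'. bip_mult \<mu> (tensor b (delta g)) (tensor b' (delta g'))"
        "\<lambda>b b'. tensor (b * lin_of (\<mu> g) b') (delta (g + g'))"])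
    (auto intro!: klinear_intros klinear_bip_mult_left klinear_bip_mult_right klinear_lin_of
      simp: bip_mult_delta)

lemma bip_one_eq: "bip_one = tensor 1 (delta 0)"
  by (simp add: bip_one_def)

lemma klinear_bip_comult: "klinear R \<Longrightarrow> klinear (\<lambda>v. bip_comult \<theta> emb (R v))"
  unfolding bip_comult_def by (intro klinear_intros)

lemma bip_comult_delta:
  "bip_comult \<theta> emb (delta (b, g)) =
    (\<Sum>l\<in>Ev. tensor (delta (b, emb l + g)) (tensor (E l (delta b)) (delta g)))"
proof -
  let ?S = "\<lambda>u b0. tensor (tensor (delta b) (u * delta g)) (tensor b0 (delta g))"
  have lin: "klinear (\<lambda>v. sweedler ?S v)"
    by (intro klinear_intros)
  have "bip_comult \<theta> emb (delta (b, g)) = sweedler ?S (coact \<theta> emb (delta b))"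
    by (simp add: bip_comult_def)
  also have "\<dots> = (\<Sum>l\<in>Ev. sweedler ?S (tensor (delta (emb l)) (E l (delta b))))"
    unfolding coact_eq by (rule klin.linear_sum[OF lin])
  also have "\<dots> = (\<Sum>l\<in>Ev. ?S (delta (emb l)) (E l (delta b)))"
    by (intro sum.cong refl sweedler_tensor klinear_intros)
  finally show ?thesis by simp
qed

text \<open>
  The coproduct in coordinates. The two components in \<open>G\<close> of a basis tensor determine the eigenvalue \<open>l\<close>
  that contributes to it, and this is what lets coproducts be compared eigenvalue by eigenvalue.
\<close>

lemma coord_bip_comult_tensor:
  "coord (bip_comult \<theta> emb (tensor x (delta g))) ((c, h), (d, k)) =
    (\<Sum>l\<in>Ev. if h = emb l + g \<and> k = g then coord x c * coord (E l (delta c)) d else 0)"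
proof -
  have lin: "klinear (\<lambda>x. bip_comult \<theta> emb (tensor x (delta g)))"
    by (intro klinear_bip_comult klinear_intros)
  have "coord (bip_comult \<theta> emb (tensor x (delta g))) ((c, h), (d, k)) =
    (\<Sum>b\<in>UNIV. coord x b * coord (bip_comult \<theta> emb (delta (b, g))) ((c, h), (d, k)))"
    by (subst klinear_coord_finite[OF lin]) simp
  also have "\<dots> = (\<Sum>b\<in>UNIV. if b = c then
      coord x c * coord (bip_comult \<theta> emb (delta (c, g))) ((c, h), (d, k)) else 0)"
    by (intro sum.cong refl) (auto simp: bip_comult_delta coord_sum coord_delta)
  also have "\<dots> = coord x c * coord (bip_comult \<theta> emb (delta (c, g))) ((c, h), (d, k))"
    by simp
  also have "\<dots> = (\<Sum>l\<in>Ev. if h = emb l + g \<and> k = g then coord x c * coord (E l (delta c)) d else 0)"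
    by (auto simp: bip_comult_delta coord_sum sum_distrib_left coord_delta intro!: sum.cong)
  finally show ?thesis .
qed

lemma bip_counit_eq_galg_counit: "bip_counit = galg_counit"
  by (rule ext) (auto simp: bip_counit_def galg_counit_def intro!: sum.cong)

lemma galg_counit_tensor_delta: "galg_counit (tensor x (delta g)) = galg_counit x"
  for x :: "'c \<Rightarrow>\<^sub>0 'k" and g :: 'g
  by (rule galg_counit_eqI[of "\<lambda>x. tensor x (delta g)" "\<lambda>x. x", OF _ _ ])
    (auto intro!: klinear_intros)

lemma klinear_bip_pi [klinear_intros]: "klinear R \<Longrightarrow> klinear (\<lambda>v. bip_pi (R v))"
  unfolding bip_pi_def by (intro klinear_intros)

lemma klinear_bip_Pi [klinear_intros]: "klinear R \<Longrightarrow> klinear (\<lambda>v. bip_Pi (R v))"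
  unfolding bip_Pi_def by (intro klinear_intros)

lemma bip_pi_tensor: "bip_pi (tensor b h) = scale (galg_counit b) h"
  unfolding bip_pi_def by (intro sweedler_tensor klinear_intros)

lemma bip_Pi_tensor: "bip_Pi (tensor b h) = scale (galg_counit h) b"
  unfolding bip_Pi_def by (intro sweedler_tensor klinear_intros)

end

section \<open>Hopf automorphisms over the projection\<close>

lemma klinear_inv:
  assumes "klinear F" "bij F" shows "klinear (inv_into UNIV F)"
proof (rule klinearI)
  have s: "surj F" and i: "inj F" using assms(2) by (auto simp: bij_def)
  show "inv_into UNIV F (u + v) = inv_into UNIV F u + inv_into UNIV F v" for u v
    by (rule inv_f_eq[OF i]) (simp add: klin.linear_add[OF assms(1)] surj_f_inv_f[OF s])
  show "inv_into UNIV F (scale c u) = scale c (inv_into UNIV F u)" for c u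
    by (rule inv_f_eq[OF i]) (simp add: klin.linear_scale[OF assms(1)] surj_f_inv_f[OF s])
qed

lemma bialg_auto_comp:
  assumes "bialg_auto m e \<Delta> \<epsilon> F" "bialg_auto m e \<Delta> \<epsilon> F'"
  shows "bialg_auto m e \<Delta> \<epsilon> (F \<circ> F')"
  using assms by (auto simp: bialg_auto_def tensor_map_comp intro: klinear_o bij_comp)

lemma bialg_auto_inv:
  assumes F: "bialg_auto m e \<Delta> \<epsilon> F"
  shows "bialg_auto m e \<Delta> \<epsilon> (inv_into UNIV F)"
proof -
  have lin: "klinear F" and bij: "bij F" using F by (auto simp: bialg_auto_def)
  have lin': "klinear (inv_into UNIV F)" by (rule klinear_inv[OF lin bij])
  have i: "inv_into UNIV F (F v) = v" for v using bij by (simp add: bij_def)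
  have s: "F (inv_into UNIV F v) = v" for v using bij by (simp add: bij_def surj_f_inv_f)
  have i': "inv_into UNIV F \<circ> F = id" using i by (simp add: fun_eq_iff)
  show ?thesis
    unfolding bialg_auto_def
  proof (intro conjI allI)
    show "bij (inv_into UNIV F)" by (rule bij_imp_bij_inv[OF bij])
    show "inv_into UNIV F (m u v) = m (inv_into UNIV F u) (inv_into UNIV F v)" for u v
    proof -
      have "m u v = F (m (inv_into UNIV F u) (inv_into UNIV F v))" using F by (simp add: bialg_auto_def s)
      then show ?thesis by (simp add: i)
    qed
    show "inv_into UNIV F e = e" using F i[of e] by (simp add: bialg_auto_def)
    show "\<Delta> (inv_into UNIV F v) = tensor_map (inv_into UNIV F) (inv_into UNIV F) (\<Delta> v)" for v
    proof -
      have "\<Delta> v = tensor_map F F (\<Delta> (inv_into UNIV F v))" using F s[of v] by (metis bialg_auto_def)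
      then show ?thesis by (simp add: tensor_map_comp lin lin' i' tensor_map_id)
    qed
    show "\<epsilon> (inv_into UNIV F v) = \<epsilon> v" for v using F s[of v] by (metis bialg_auto_def)
  qed (rule lin')
qed

context abelian_biproduct
begin

lemma Aut_Hopf_comp:
  assumes "F \<in> carrier (Aut_Hopf \<mu> \<theta> emb)" "F' \<in> carrier (Aut_Hopf \<mu> \<theta> emb)"
  shows "F \<circ> F' \<in> carrier (Aut_Hopf \<mu> \<theta> emb)"
  using assms by (auto simp: Aut_Hopf_def bialg_auto_comp o_assoc)

lemma Aut_Hopf_inv:
  assumes "F \<in> carrier (Aut_Hopf \<mu> \<theta> emb)"
  shows "inv_into UNIV F \<in> carrier (Aut_Hopf \<mu> \<theta> emb)"
proof -
  have F: "bialg_auto (bip_mult \<mu>) bip_one (bip_comult \<theta> emb) bip_counit F" "bip_pi \<circ> F = bip_pi"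
    using assms by (auto simp: Aut_Hopf_def)
  have "surj F" using F(1) by (auto simp: bialg_auto_def bij_def)
  have "bip_pi \<circ> inv_into UNIV F = bip_pi \<circ> F \<circ> inv_into UNIV F" by (simp add: F(2))
  also have "\<dots> = bip_pi" using \<open>surj F\<close> by (simp add: fun_eq_iff surj_f_inv_f)
  finally show ?thesis using bialg_auto_inv[OF F(1)] by (simp add: Aut_Hopf_def)
qed

text \<open>
  Radford's splitting of the biproduct as a coalgebra: \<open>\<Pi>\<close> and \<open>\<pi>\<close> recover an element from its coproduct,
  since the counit kills the eigenspaces for eigenvalues other than \<open>1\<close>.
\<close>

lemma Pi_pi_comult: "tensor_map bip_Pi bip_pi (bip_comult \<theta> emb v) = v"
proof (rule klinear_eqI[of "\<lambda>v. tensor_map bip_Pi bip_pi (bip_comult \<theta> emb v)"])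
  fix x :: "'c \<times> 'g"
  obtain b g where x: "x = (b, g)" by (cases x)
  have "tensor_map bip_Pi bip_pi (bip_comult \<theta> emb (delta x)) =
    (\<Sum>l\<in>Ev. tensor_map bip_Pi bip_pi (tensor (delta (b, emb l + g)) (tensor (E l (delta b)) (delta g))))"
    unfolding x bip_comult_delta
    by (rule klin.linear_sum) (intro klinear_intros)
  also have "\<dots> = (\<Sum>l\<in>Ev. if l = 1 then delta (b, g) else 0)"
  proof (intro sum.cong refl)
    fix l
    have "bip_Pi (delta (b, emb l + g)) = (delta b :: _ \<Rightarrow>\<^sub>0 'k)"
      using bip_Pi_tensor[of "delta b" "delta (emb l + g)"] by simp
    then show "tensor_map bip_Pi bip_pi (tensor (delta (b, emb l + g)) (tensor (E l (delta b)) (delta g)))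
        = (if l = 1 then delta (b, g) else 0)"
      by (subst tensor_map_tensor)
        (auto intro!: klinear_intros simp: bip_pi_tensor counit_eigenproj
          klin.linear_0[OF klinear_tensor_right[OF klinear_ident]])
  qed
  finally show "tensor_map bip_Pi bip_pi (bip_comult \<theta> emb (delta x)) = delta x"
    using one_in_Ev by (simp add: finite_eigenvalues[OF diag] x)
qed (intro klinear_intros klinear_bip_comult)+

lemma lin_of_one [simp]: "lin_of (\<mu> g) 1 = (1 :: 'c \<Rightarrow>\<^sub>0 'k)"
  using lin_of_delta[of "\<mu> g" 0] by simp

lemma lin_of_zero_id [simp]: "lin_of (\<mu> 0) b = (b :: 'c \<Rightarrow>\<^sub>0 'k)"
proof (rule klinear_eqI[of "lin_of (\<mu> 0)"])
  have "bij (\<mu> 0)"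
    using \<mu>_hom by (auto simp: AutoGroup_def auto_def Bij_def hom_def grp_def)
  then have "\<mu> 0 x = x" for x
    using \<mu>_add[of 0 0 x] by (simp add: bij_def inj_eq)
  then show "lin_of (\<mu> 0) (delta x) = delta x" for x by simp
qed (use klinear_lin_of[OF klinear_ident] in \<open>auto intro!: klinear_intros\<close>)

lemma tensor_delta_inject: "tensor u (delta g) = tensor v (delta g) \<Longrightarrow> u = v"
  for u v :: "'c \<Rightarrow>\<^sub>0 'k" and g :: 'g
  by (drule arg_cong[of _ _ bip_Pi]) (simp add: bip_Pi_tensor)

context
  fixes F
  assumes F: "F \<in> carrier (Aut_Hopf \<mu> \<theta> emb)"
begin

lemma
  shows klinear_Aut_Hopf: "klinear F" and bij_Aut_Hopf: "bij F"
    and Aut_Hopf_mult: "F (bip_mult \<mu> u v) = bip_mult \<mu> (F u) (F v)"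
    and Aut_Hopf_one: "F bip_one = bip_one"
    and Aut_Hopf_comult: "bip_comult \<theta> emb (F v) = tensor_map F F (bip_comult \<theta> emb v)"
    and Aut_Hopf_counit: "galg_counit (F v) = galg_counit v"
    and Aut_Hopf_pi: "bip_pi (F v) = bip_pi v"
  using F by (auto simp: Aut_Hopf_def bialg_auto_def bip_counit_eq_galg_counit fun_eq_iff)

lemma klinear_Aut_Hopf_app: "klinear S \<Longrightarrow> klinear (\<lambda>v. F (S v))"
  by (rule klinear_compose[OF klinear_Aut_Hopf])

text \<open>
  Apply the splitting to \<open>F v\<close> and use that \<open>F\<close> preserves coproducts and \<open>\<pi>\<close>. So \<open>F\<close> does not change the
  component in \<open>G\<close> of a basis vector.
\<close>

lemma Aut_Hopf_delta: "F (delta (b, g)) = tensor (bip_Pi (F (delta (b, g)))) (delta g)"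
proof -
  have "F v = tensor_map (\<lambda>v. bip_Pi (F v)) bip_pi (bip_comult \<theta> emb v)" for v
  proof -
    have "F v = tensor_map bip_Pi bip_pi (tensor_map F F (bip_comult \<theta> emb v))"
      by (simp add: Pi_pi_comult flip: Aut_Hopf_comult)
    also have "\<dots> = tensor_map (bip_Pi \<circ> F) (bip_pi \<circ> F) (bip_comult \<theta> emb v)"
      by (intro tensor_map_comp klinear_Aut_Hopf klinear_bip_Pi[of "\<lambda>v. v", OF klinear_ident]
          klinear_bip_pi[of "\<lambda>v. v", OF klinear_ident])
    finally show ?thesis using Aut_Hopf_pi by (simp add: o_def)
  qed
  from this[of "delta (b, g)"] have "F (delta (b, g)) = tensor_map (\<lambda>v. bip_Pi (F v)) bip_pi
    (\<Sum>l\<in>Ev. tensor (delta (b, emb l + g)) (tensor (E l (delta b)) (delta g)))"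
    unfolding bip_comult_delta .
  also have "\<dots> = (\<Sum>l\<in>Ev. tensor_map (\<lambda>v. bip_Pi (F v)) bip_pi
      (tensor (delta (b, emb l + g)) (tensor (E l (delta b)) (delta g))))"
    by (rule klin.linear_sum) (intro klinear_intros)
  also have "\<dots> = (\<Sum>l\<in>Ev. if l = 1 then tensor (bip_Pi (F (delta (b, g)))) (delta g) else 0)"
  proof (intro sum.cong refl)
    fix l
    show "tensor_map (\<lambda>v. bip_Pi (F v)) bip_pi (tensor (delta (b, emb l + g)) (tensor (E l (delta b)) (delta g)))
        = (if l = 1 then tensor (bip_Pi (F (delta (b, g)))) (delta g) else 0)"
      by (subst tensor_map_tensor)
        (auto intro!: klinear_intros klinear_Aut_Hopf_app simp: bip_pi_tensor counit_eigenproj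
          klin.linear_0[OF klinear_tensor_right[OF klinear_ident]])
  qed
  finally show ?thesis
    using one_in_Ev by (simp add: finite_eigenvalues[OF diag])
qed

lemma Aut_Hopf_tensor_Pi: "F (tensor b (delta g)) = tensor (bip_Pi (F (tensor b (delta g)))) (delta g)"
  by (rule klinear_eqI[of "\<lambda>b. F (tensor b (delta g))"
        "\<lambda>b. tensor (bip_Pi (F (tensor b (delta g)))) (delta g)"])
    (auto intro!: klinear_intros klinear_Aut_Hopf_app simp: Aut_Hopf_delta[symmetric])

lemma klinear_left_part_app: "klinear S \<Longrightarrow> klinear (\<lambda>v. left_part F (S v))"
  unfolding left_part_def by (intro klinear_intros klinear_Aut_Hopf_app)

lemma klinear_left_part: "klinear (left_part F)"
  using klinear_left_part_app[OF klinear_ident] by simp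

lemma klinear_right_part: "klinear S \<Longrightarrow> klinear (\<lambda>v. right_part F (S v))"
  unfolding right_part_def by (intro klinear_intros klinear_Aut_Hopf_app)

lemma Aut_Hopf_left: "F (tensor b (delta 0)) = tensor (left_part F b) (delta 0)"
  using Aut_Hopf_tensor_Pi[of b 0] by (simp add: left_part_def)

lemma Aut_Hopf_right: "F (tensor 1 (delta g)) = tensor (right_part F (delta g)) (delta g)"
  using Aut_Hopf_tensor_Pi[of 1 g] by (simp add: right_part_def)

text \<open>
  Factor \<open>b \<times> g\<close> as \<open>(b \<times> 1) (1 \<times> g)\<close>. This exhibits \<open>F\<close> as \<open>\<Phi>\<close> applied to its two parts.
\<close>

lemma Aut_Hopf_tensor: "F (tensor b (delta g)) = tensor (left_part F b * right_part F (delta g)) (delta g)"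
proof -
  have "tensor b (delta g) = bip_mult \<mu> (tensor b (delta 0)) (tensor 1 (delta g))"
    by (subst bip_mult_tensor) simp
  \<comment> \<open>\<open>delta 0\<close> must not be rewritten to \<open>1\<close> here, because the rules for \<open>F\<close> and the product expect a
    group element in the second factor.\<close>
  then have "F (tensor b (delta g)) =
      bip_mult \<mu> (tensor (left_part F b) (delta 0)) (tensor (right_part F (delta g)) (delta g))"
    by (simp add: Aut_Hopf_mult Aut_Hopf_left Aut_Hopf_right del: single_one)
  then show ?thesis by (simp add: bip_mult_tensor del: single_one)
qed

lemma left_part_mult: "left_part F (b * b') = left_part F b * left_part F b'"
proof -
  have "tensor (left_part F (b * b')) (delta 0) =
      F (bip_mult \<mu> (tensor b (delta 0)) (tensor b' (delta 0)))"
    by (subst bip_mult_tensor) (simp add: Aut_Hopf_left del: single_one)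
  also have "\<dots> = tensor (left_part F b * left_part F b') (delta 0)"
    unfolding Aut_Hopf_mult Aut_Hopf_left unfolding bip_mult_tensor by (simp del: single_one)
  finally show ?thesis by (rule tensor_delta_inject)
qed

lemma left_part_one: "left_part F 1 = 1"
  using Aut_Hopf_one Aut_Hopf_left[of 1] tensor_delta_inject[of 1 0 "left_part F 1"] unfolding bip_one_eq by argo

lemma right_part_zero: "right_part F (delta 0) = 1"
  using Aut_Hopf_one Aut_Hopf_right[of 0] tensor_delta_inject[of 1 0 "right_part F (delta 0)"] unfolding bip_one_eq by argo

lemma right_part_add: "right_part F (delta (g + h)) = right_part F (delta g) * lin_of (\<mu> g) (right_part F (delta h))"
proof -
  have "tensor (right_part F (delta (g + h))) (delta (g + h)) =
      F (bip_mult \<mu> (tensor 1 (delta g)) (tensor 1 (delta h)))"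
    by (subst bip_mult_tensor) (simp add: Aut_Hopf_right)
  also have "\<dots> = tensor (right_part F (delta g) * lin_of (\<mu> g) (right_part F (delta h))) (delta (g + h))"
    unfolding Aut_Hopf_mult Aut_Hopf_right unfolding bip_mult_tensor ..
  finally show ?thesis by (rule tensor_delta_inject)
qed

text \<open>
  Applying \<open>F\<close> to \<open>(1 \<times> g) (b \<times> 1) = \<mu> g b \<times> g\<close> gives the claim multiplied by the right part at \<open>g\<close>;
  it can be cancelled because the cocycle identity for \<open>g + (- g) = 0\<close> makes it a unit.
\<close>

lemma left_part_act: "left_part F (lin_of (\<mu> g) b) = lin_of (\<mu> g) (left_part F b)"
proof -
  have "tensor (left_part F (lin_of (\<mu> g) b) * right_part F (delta g)) (delta g) =
      F (bip_mult \<mu> (tensor 1 (delta g)) (tensor b (delta 0)))"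
    by (subst bip_mult_tensor) (simp add: Aut_Hopf_tensor)
  also have "\<dots> = tensor (right_part F (delta g) * lin_of (\<mu> g) (left_part F b)) (delta (g + 0))"
    unfolding Aut_Hopf_mult Aut_Hopf_right Aut_Hopf_left unfolding bip_mult_tensor ..
  finally have "left_part F (lin_of (\<mu> g) b) * right_part F (delta g) = lin_of (\<mu> g) (left_part F b) * right_part F (delta g)"
    by (simp add: mult.commute tensor_delta_inject)
  then have "left_part F (lin_of (\<mu> g) b) * (right_part F (delta g) * lin_of (\<mu> g) (right_part F (delta (- g)))) =
      lin_of (\<mu> g) (left_part F b) * (right_part F (delta g) * lin_of (\<mu> g) (right_part F (delta (- g))))"
    by (simp flip: mult.assoc)
  then show ?thesis using right_part_add[of g "- g"] right_part_zero by simp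
qed

lemma counit_left_part: "galg_counit (left_part F b) = galg_counit b"
  using Aut_Hopf_counit[of "tensor b (delta 0)"] unfolding Aut_Hopf_left by (simp add: galg_counit_tensor_delta del: single_one)

lemma counit_right_part: "galg_counit (right_part F (delta g)) = 1"
  using Aut_Hopf_counit[of "tensor 1 (delta g)"] unfolding Aut_Hopf_right by (simp add: galg_counit_tensor_delta)

end

end

section \<open>Comparison of coproducts\<close>

text \<open>
  Group algebras are cocommutative, and this survives applying the same map to both factors.
\<close>

lemma coord_tensor_map_comult_swap:
  fixes v :: "'x::finite \<Rightarrow>\<^sub>0 'k::field"
  shows "coord (tensor_map S S (galg_comult v)) (c, d) = coord (tensor_map S S (galg_comult v)) (d, c)"
proof -
  have lin: "klinear (\<lambda>v. tensor_map S S (galg_comult v))" by (intro klinear_intros)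
  show ?thesis
    by (simp add: klinear_coord_finite[OF lin, of v] mult.commute)
qed

lemma coord_galg_comult:
  fixes v :: "'x::finite \<Rightarrow>\<^sub>0 'k::field"
  shows "coord (galg_comult v) (c, d) = (if c = d then coord v c else 0)"
proof -
  have lin: "klinear (\<lambda>v :: 'x \<Rightarrow>\<^sub>0 'k. galg_comult v)" by (intro klinear_intros)
  have "coord (galg_comult v) (c, d) = (\<Sum>x\<in>UNIV. if x = c then (if c = d then coord v c else 0) else 0)"
    unfolding klinear_coord_finite[OF lin, of v] by (intro sum.cong refl) (auto simp: coord_delta)
  then show ?thesis by simp
qed

context abelian_biproduct
begin

lemma galg_counit_mult_delta: "galg_counit (v * delta x) = galg_counit v" for v :: "'c \<Rightarrow>\<^sub>0 'k"
  by (rule galg_counit_eqI[of "\<lambda>v. v * delta x" "\<lambda>v. v"]) (auto intro!: klinear_intros simp: mult_single)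

lemma coord_bip_comult_at:
  assumes "m \<in> Ev"
  shows "coord (bip_comult \<theta> emb (tensor x (delta g))) ((c, emb m + g), (d, g)) =
    coord x c * coord (E m (delta c)) d"
proof -
  have "emb m = emb l \<longleftrightarrow> m = l" if "l \<in> Ev" for l
    using emb_inj Ev_subset_U assms that by (auto dest: inj_onD)
  then have "coord (bip_comult \<theta> emb (tensor x (delta g))) ((c, emb m + g), (d, g)) =
      (\<Sum>l\<in>Ev. if l = m then coord x c * coord (E m (delta c)) d else 0)"
    unfolding coord_bip_comult_tensor by (intro sum.cong refl) auto
  then show ?thesis using assms by (simp add: finite_eigenvalues[OF diag])
qed

lemma eigenproj_one: "E l 1 = (if l = 1 then 1 else 0)"
proof -
  have "T (delta 0) = delta 0" unfolding lin_of_delta by simp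
  then have "T 1 = 1" by simp
  then have "1 \<in> eigenspace T 1" by (simp add: eigenspace_def)
  from eigenproj_eigenspace[OF diag this, of l] show ?thesis by auto
qed

lemma bip_comult_right: "bip_comult \<theta> emb (tensor 1 (delta g)) =
  (tensor (tensor 1 (delta g)) (tensor 1 (delta g)) :: _ \<Rightarrow>\<^sub>0 'k)"
proof -
  have z: "tensor u 0 = 0" "tensor 0 w = 0" for u :: "'x \<Rightarrow>\<^sub>0 'k" and w :: "'y \<Rightarrow>\<^sub>0 'k"
    by (auto intro!: coord_eqI)
  have "bip_comult \<theta> emb (tensor 1 (delta g)) =
    (bip_comult \<theta> emb (delta (0, g)) :: _ \<Rightarrow>\<^sub>0 'k)"
    by (simp flip: tensor_delta)
  also have "\<dots> = (\<Sum>l\<in>Ev. if l = 1 then tensor (delta (0, g)) (tensor 1 (delta g)) else 0)"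
    unfolding bip_comult_delta by (intro sum.cong refl) (auto simp: eigenproj_one z)
  also have "\<dots> = tensor (delta (0, g)) (tensor 1 (delta g))"
    using one_in_Ev by (simp add: finite_eigenvalues[OF diag])
  finally show ?thesis by (simp flip: tensor_delta)
qed

lemma delta_inject: "(delta x :: 'x \<Rightarrow>\<^sub>0 'k) = delta y \<longleftrightarrow> x = y"
  by (metis coord_delta zero_neq_one)

context
  fixes F
  assumes F: "F \<in> carrier (Aut_Hopf \<mu> \<theta> emb)"
begin

text \<open>
  \<open>1 \<times> g\<close> is group-like, hence so is its image; compare coefficients for the eigenvalue \<open>m\<close>.
\<close>

lemma right_part_comult:
  assumes "m \<in> Ev"
  shows "coord (right_part F (delta g)) c * coord (E m (delta c)) d =
    (if m = 1 then coord (right_part F (delta g)) c * coord (right_part F (delta g)) d else 0)"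
proof -
  have "bip_comult \<theta> emb (tensor (right_part F (delta g)) (delta g)) =
      tensor (tensor (right_part F (delta g)) (delta g)) (tensor (right_part F (delta g)) (delta g))"
    using Aut_Hopf_comult[OF F, of "tensor 1 (delta g)"]
    by (simp add: bip_comult_right Aut_Hopf_right[OF F] tensor_map_tensor klinear_Aut_Hopf[OF F])
  then have "coord (bip_comult \<theta> emb (tensor (right_part F (delta g)) (delta g))) ((c, emb m + g), (d, g)) =
      coord (tensor (tensor (right_part F (delta g)) (delta g)) (tensor (right_part F (delta g)) (delta g))) ((c, emb m + g), (d, g))"
    by simp
  moreover have "emb m = 0 \<longleftrightarrow> m = 1"
    using emb_inj Ev_subset_U assms one_in_U by (auto simp flip: emb_one dest: inj_onD)
  moreover have "g = emb m + g \<longleftrightarrow> emb m = 0"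
    using add_right_cancel[of 0 g "emb m"] by auto
  ultimately show ?thesis
    unfolding coord_bip_comult_at[OF assms]
    by (auto simp: coord_delta)
qed

text \<open>
  A group element \<open>c\<close> in the support of the right part has no component in the eigenspaces for \<open>m \<noteq> 1\<close>, so
  it is fixed by \<open>\<theta>\<close>. The component for \<open>1\<close> then says that the right part is \<open>c\<close> itself.
\<close>

lemma right_part_grouplike: "\<exists>c. right_part F (delta g) = delta c \<and> \<theta> c = c"
proof -
  have "(\<Sum>c\<in>UNIV. coord (right_part F (delta g)) c) \<noteq> 0"
    using counit_right_part[OF F, of g] by (simp add: galg_counit_UNIV)
  then have "\<exists>c. coord (right_part F (delta g)) c \<noteq> 0"
    using sum.not_neutral_contains_not_neutral by blast
  then obtain c where c: "coord (right_part F (delta g)) c \<noteq> 0" by blast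
  have E0: "E m (delta c) = 0" if "m \<in> Ev" "m \<noteq> 1" for m
    using right_part_comult[OF that(1), of g c] c that(2) by (auto intro!: coord_eqI)
  have "delta c = (\<Sum>m\<in>Ev. E m (delta c))" by (simp add: sum_eigenproj[OF diag])
  also have "\<dots> = (\<Sum>m\<in>Ev. if m = 1 then E 1 (delta c) else 0)"
    by (intro sum.cong refl) (auto simp: E0)
  also have "\<dots> = E 1 (delta c)" using one_in_Ev by (simp add: finite_eigenvalues[OF diag])
  finally have E1: "E 1 (delta c) = delta c" by simp
  have "right_part F (delta g) = delta c"
    by (rule coord_eqI) (use right_part_comult[OF one_in_Ev, of g c] c E1 in auto)
  moreover have "\<theta> c = c"
    using eigenproj_in_eigenspace[OF diag, of 1 "delta c"] E1
    by (simp add: coord_delta poly_mapping_eq_iff fun_eq_iff) (metis zero_neq_one)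
  ultimately show ?thesis by blast
qed

text \<open>
  The right part of an automorphism on group elements, as a map between groups. It is a crossed
  homomorphism into the \<open>\<theta>\<close>-fixed elements, and a homomorphism on the central subgroup of the
  eigenvalues.
\<close>

definition shift :: "'g \<Rightarrow> 'c" where
  "shift g = (SOME c. right_part F (delta g) = delta c)"

lemma right_part_eq_shift: "right_part F (delta g) = delta (shift g)"
  unfolding shift_def using someI_ex[of "\<lambda>c. right_part F (delta g) = delta c"] right_part_grouplike by blast

lemma \<theta>_shift: "\<theta> (shift g) = shift g"
  using right_part_grouplike[of g] by (auto simp: right_part_eq_shift delta_inject)

lemma shift_zero [simp]: "shift 0 = 0"
  using right_part_zero[OF F] unfolding right_part_eq_shift by (metis delta_inject single_one)

lemma shift_add: "shift (g + h) = shift g + \<mu> g (shift h)"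
  using right_part_add[OF F, of g h] unfolding right_part_eq_shift by (simp add: delta_inject mult_single)

lemma shift_emb_mult:
  assumes "l \<in> U" "m \<in> U"
  shows "shift (emb (l * m)) = shift (emb l) + shift (emb m)"
  using assms by (simp add: emb_mult shift_add \<mu>_emb)

lemma bip_comult_left_part:
  "bip_comult \<theta> emb (tensor (left_part F (delta b)) (delta 0)) =
    (\<Sum>l\<in>Ev. tensor (tensor (left_part F (delta b) * delta (shift (emb l))) (delta (emb l)))
      (tensor (left_part F (E l (delta b))) (delta 0)))"
proof -
  have "bip_comult \<theta> emb (tensor (left_part F (delta b)) (delta 0)) =
      tensor_map F F (bip_comult \<theta> emb (delta (b, 0)))"
    unfolding Aut_Hopf_comult[OF F, symmetric] using Aut_Hopf_left[OF F, of "delta b"]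
    by (simp add: tensor_delta del: single_one)
  also have "\<dots> = (\<Sum>l\<in>Ev. tensor_map F F (tensor (delta (b, emb l + 0)) (tensor (E l (delta b)) (delta 0))))"
    unfolding bip_comult_delta by (rule klin.linear_sum) (intro klinear_intros)
  also have "\<dots> = (\<Sum>l\<in>Ev. tensor (tensor (left_part F (delta b) * delta (shift (emb l))) (delta (emb l)))
      (tensor (left_part F (E l (delta b))) (delta 0)))"
  proof (intro sum.cong refl)
    fix l
    have "F (delta (b, emb l + 0)) = tensor (left_part F (delta b) * delta (shift (emb l))) (delta (emb l))"
      using Aut_Hopf_tensor[OF F, of "delta b" "emb l"] by (simp add: right_part_eq_shift)
    then show "tensor_map F F (tensor (delta (b, emb l + 0)) (tensor (E l (delta b)) (delta 0))) =
        tensor (tensor (left_part F (delta b) * delta (shift (emb l))) (delta (emb l)))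
          (tensor (left_part F (E l (delta b))) (delta 0))"
      using Aut_Hopf_left[OF F, of "E l (delta b)"]
      by (simp add: tensor_map_tensor klinear_Aut_Hopf[OF F] del: single_one)
  qed
  finally show ?thesis .
qed

text \<open>
  The coefficients for the eigenvalue \<open>m\<close> in the coproduct of the image of \<open>b \<times> 1\<close>, computed before and
  after applying \<open>F\<close>.
\<close>

lemma left_part_comult:
  assumes "m \<in> Ev"
  shows "coord (left_part F (delta b)) c * coord (E m (delta c)) d =
    coord (left_part F (delta b) * delta (shift (emb m))) c * coord (left_part F (E m (delta b))) d"
proof -
  have inj: "emb l = emb m \<longleftrightarrow> l = m" if "l \<in> Ev" for l
    using emb_inj Ev_subset_U assms that by (auto dest: inj_onD)
  have "coord (left_part F (delta b)) c * coord (E m (delta c)) d =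
      coord (bip_comult \<theta> emb (tensor (left_part F (delta b)) (delta 0))) ((c, emb m + 0), (d, 0))"
    by (rule coord_bip_comult_at[OF assms, symmetric])
  also have "\<dots> = (\<Sum>l\<in>Ev. if l = m then
      coord (left_part F (delta b) * delta (shift (emb m))) c * coord (left_part F (E m (delta b))) d else 0)"
    unfolding bip_comult_left_part coord_sum coord_tensor
    by (intro sum.cong refl) (auto simp: coord_delta inj simp del: single_one)
  also have "\<dots> = coord (left_part F (delta b) * delta (shift (emb m))) c * coord (left_part F (E m (delta b))) d"
    using assms by (simp add: finite_eigenvalues[OF diag])
  finally show ?thesis .
qed

text \<open>
  Apply the counit to the first tensor factor in the comparison of coproducts; the factor
  \<open>shift (emb m)\<close> disappears because it is a group element.
\<close>

lemma left_part_eigenproj: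
  assumes "m \<in> Ev"
  shows "left_part F (E m v) = E m (left_part F v)"
proof (rule klinear_eqI[of "\<lambda>v. left_part F (E m v)"])
  fix b
  show "left_part F (E m (delta b)) = E m (left_part F (delta b))"
  proof (rule coord_eqI)
    fix d
    have "coord (E m (left_part F (delta b))) d = (\<Sum>c\<in>UNIV. coord (left_part F (delta b)) c * coord (E m (delta c)) d)"
      by (rule klinear_coord_finite[OF klinear_eigenproj[OF diag]])
    also have "\<dots> = galg_counit (left_part F (delta b) * delta (shift (emb m))) * coord (left_part F (E m (delta b))) d"
      by (simp add: left_part_comult[OF assms] galg_counit_UNIV sum_distrib_right)
    also have "\<dots> = coord (left_part F (E m (delta b))) d"
      by (simp add: galg_counit_mult_delta counit_left_part[OF F])
    finally show "coord (left_part F (E m (delta b))) d = coord (E m (left_part F (delta b))) d" by simp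
  qed
qed (intro klinear_left_part_app[OF F] klinear_E klinear_left_part klinear_intros F)+

text \<open>
  Sum the comparison of coproducts over all eigenvalues. The left part fails to be a coalgebra map exactly
  through the factors \<open>shift (emb m)\<close>.
\<close>

lemma galg_comult_left_part:
  "galg_comult (left_part F (delta b)) =
    (\<Sum>m\<in>Ev. tensor (left_part F (delta b) * delta (shift (emb m))) (left_part F (E m (delta b))))"
proof (rule coord_eqI)
  fix x :: "'c \<times> 'c"
  obtain c d where x: "x = (c, d)" by (cases x)
  have "coord (galg_comult (left_part F (delta b))) x = coord (left_part F (delta b)) c * coord (delta c) d"
    by (simp add: x coord_galg_comult coord_delta)
  also have "coord (delta c) d = (\<Sum>m\<in>Ev. coord (E m (delta c)) d)"
    by (simp add: sum_eigenproj[OF diag] flip: coord_sum)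
  finally show "coord (galg_comult (left_part F (delta b))) x = coord (\<Sum>m\<in>Ev.
      tensor (left_part F (delta b) * delta (shift (emb m))) (left_part F (E m (delta b)))) x"
    by (simp add: x coord_sum sum_distrib_left left_part_comult)
qed

end

lemma left_part_inv:
  assumes F: "F \<in> carrier (Aut_Hopf \<mu> \<theta> emb)"
  shows "left_part (inv_into UNIV F) (left_part F b) = b"
    and "left_part F (left_part (inv_into UNIV F) b) = b"
proof -
  let ?F' = "inv_into UNIV F"
  note F' = Aut_Hopf_inv[OF F]
  have "tensor (left_part ?F' (left_part F b)) (delta 0) = ?F' (F (tensor b (delta 0)))"
    by (simp only: Aut_Hopf_left[OF F] Aut_Hopf_left[OF F'])
  also have "\<dots> = tensor b (delta 0)" using bij_Aut_Hopf[OF F] by (simp add: bij_def)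
  finally show "left_part ?F' (left_part F b) = b" by (rule tensor_delta_inject)
  have "tensor (left_part F (left_part ?F' b)) (delta 0) = F (?F' (tensor b (delta 0)))"
    by (simp only: Aut_Hopf_left[OF F] Aut_Hopf_left[OF F'])
  also have "\<dots> = tensor b (delta 0)" using bij_Aut_Hopf[OF F] by (simp add: bij_def surj_f_inv_f)
  finally show "left_part F (left_part ?F' b) = b" by (rule tensor_delta_inject)
qed

text \<open>
  Evaluate \<open>inv F (F (1 \<times> g)) = 1 \<times> g\<close>. In particular the left part of \<open>inv F\<close> sends the group elements
  \<open>shift F g\<close> to group elements.
\<close>

lemma left_part_inv_shift:
  assumes F: "F \<in> carrier (Aut_Hopf \<mu> \<theta> emb)"
  shows "left_part (inv_into UNIV F) (delta (shift F g)) = delta (- shift (inv_into UNIV F) g)"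
proof -
  let ?F' = "inv_into UNIV F"
  note F' = Aut_Hopf_inv[OF F]
  have "tensor (left_part ?F' (delta (shift F g)) * delta (shift ?F' g)) (delta g) =
      ?F' (F (tensor 1 (delta g)))"
    by (simp add: Aut_Hopf_right[OF F] Aut_Hopf_tensor[OF F'] right_part_eq_shift[OF F] right_part_eq_shift[OF F'] del: tensor_delta)
  also have "\<dots> = tensor 1 (delta g)" using bij_Aut_Hopf[OF F] by (simp add: bij_def)
  finally have "left_part ?F' (delta (shift F g)) * delta (shift ?F' g) = 1"
    by (rule tensor_delta_inject)
  then have "(left_part ?F' (delta (shift F g)) * delta (shift ?F' g)) * delta (- shift ?F' g) =
      delta (- shift ?F' g)"
    by simp
  then show ?thesis by (simp only: mult.assoc delta_mult) simp
qed

text \<open>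
  Transport the coproduct of \<open>F\<^sub>L b\<close> back to \<open>B\<close> along the inverse of \<open>F\<^sub>L\<close>: the result is a twisted
  coproduct of \<open>b\<close>, and it inherits cocommutativity.
\<close>

lemma twisted_comult_symmetric:
  assumes F: "F \<in> carrier (Aut_Hopf \<mu> \<theta> emb)"
  defines "s \<equiv> \<lambda>m. - shift (inv_into UNIV F) (emb m)"
  shows "coord (\<Sum>m\<in>Ev. tensor (delta (b + s m)) (E m (delta b))) (c, d) =
    coord (\<Sum>m\<in>Ev. tensor (delta (b + s m)) (E m (delta b))) (d, c)"
proof -
  let ?F' = "inv_into UNIV F"
  note F' = Aut_Hopf_inv[OF F]
  let ?L = "left_part F" and ?L' = "left_part ?F'"
  have "tensor_map ?L' ?L' (galg_comult (?L (delta b))) =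
    (\<Sum>m\<in>Ev. tensor_map ?L' ?L' (tensor (?L (delta b) * delta (shift F (emb m))) (?L (E m (delta b)))))"
    unfolding galg_comult_left_part[OF F] by (rule klin.linear_sum) (intro klinear_intros)
  also have "\<dots> = (\<Sum>m\<in>Ev. tensor (delta (b + s m)) (E m (delta b)))"
    by (intro sum.cong refl)
      (simp add: tensor_map_tensor klinear_left_part[OF F'] left_part_mult[OF F'] left_part_inv[OF F]
        left_part_inv_shift[OF F] mult_single s_def)
  finally show ?thesis
    using coord_tensor_map_comult_swap[of ?L' "?L (delta b)" c d] by (simp only:)
qed

lemma left_part_Aut_YD:
  assumes F: "F \<in> carrier (Aut_Hopf \<mu> \<theta> emb)"
    and trivial: "\<And>l. l \<in> Ev \<Longrightarrow> shift F (emb l) = 0"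
  shows "left_part F \<in> carrier (Aut_YD_Hopf \<mu> \<theta> emb)"
proof -
  let ?L = "left_part F"
  have "bij ?L"
    by (rule o_bij[of "left_part (inv_into UNIV F)"]) (auto simp: fun_eq_iff left_part_inv[OF F])
  moreover have "galg_comult (?L v) = tensor_map ?L ?L (galg_comult v)" for v
  proof (rule klinear_eqI[of "\<lambda>v. galg_comult (?L v)"])
    fix b
    have "galg_comult (?L (delta b)) = (\<Sum>m\<in>Ev. tensor (?L (delta b)) (?L (E m (delta b))))"
      by (simp add: galg_comult_left_part[OF F] trivial)
    also have "\<dots> = tensor (?L (delta b)) (?L (\<Sum>m\<in>Ev. E m (delta b)))"
      by (simp add: klin.linear_sum[OF klinear_left_part[OF F]]
          klin.linear_sum[OF klinear_tensor_right[OF klinear_ident]])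
    finally show "galg_comult (?L (delta b)) = tensor_map ?L ?L (galg_comult (delta b))"
      by (simp add: sum_eigenproj[OF diag])
  qed (intro klinear_intros klinear_left_part_app[OF F])+
  moreover have "?L (act \<mu> h b) = act \<mu> h (?L b)" for h b
    by (rule klinear_eqI[of "\<lambda>h. ?L (act \<mu> h b)" "\<lambda>h. act \<mu> h (?L b)"])
      (auto intro!: klinear_intros klinear_left_part_app[OF F] simp: act_delta left_part_act[OF F])
  moreover have "coact \<theta> emb (?L b) = tensor_map id ?L (coact \<theta> emb b)" for b
  proof -
    have "tensor_map id ?L (coact \<theta> emb b) =
        (\<Sum>l\<in>Ev. tensor_map id ?L (tensor (delta (emb l)) (E l b)))"
      unfolding coact_eq by (rule klin.linear_sum) (intro klinear_intros)
    also have "\<dots> = (\<Sum>l\<in>Ev. tensor (delta (emb l)) (E l (?L b)))"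
      by (intro sum.cong refl) (simp add: tensor_map_tensor klinear_id klinear_left_part[OF F] left_part_eigenproj[OF F])
    finally show ?thesis by (simp add: coact_eq)
  qed
  ultimately show ?thesis
    using klinear_left_part[OF F] left_part_mult[OF F] left_part_one[OF F] counit_left_part[OF F]
    by (simp add: Aut_YD_Hopf_def bialg_auto_def)
qed

end

section \<open>The isomorphism when the shifts are trivial\<close>

context abelian_biproduct
begin

lemma klinear_Phi: "klinear (Phi_YD (g, f))"
  unfolding Phi_YD_def prod.case by (intro klinear_sweedler[OF klinear_ident])

lemma Phi_delta: "Phi_YD (g, f) (delta (b, h)) = tensor (f (delta b) * g (delta h)) (delta h)"
  by (simp add: Phi_YD_def)

lemma Phi_tensor:
  assumes "klinear f"
  shows "Phi_YD (g, f) (tensor b (delta h)) = tensor (f b * g (delta h)) (delta h)"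
  by (rule klinear_eqI[of "\<lambda>b. Phi_YD (g, f) (tensor b (delta h))"])
    (auto intro!: klinear_intros klinear_compose[OF klinear_Phi] assms simp: Phi_delta)

text \<open>
  The unit of the convolution product.
\<close>

abbreviation counit_map :: "('g \<Rightarrow>\<^sub>0 'k) \<Rightarrow> ('c \<Rightarrow>\<^sub>0 'k)" where
  "counit_map \<equiv> \<lambda>h. scale (galg_counit h) 1"

context
  fixes f
  assumes f: "f \<in> carrier (Aut_YD_Hopf \<mu> \<theta> emb)"
begin

lemma
  shows klinear_Aut_YD: "klinear f" and bij_Aut_YD: "bij f" and Aut_YD_mult: "f (u * v) = f u * f v"
    and Aut_YD_one: "f 1 = 1" and Aut_YD_comult: "galg_comult (f v) = tensor_map f f (galg_comult v)"
    and Aut_YD_counit: "galg_counit (f v) = galg_counit v"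
    and Aut_YD_act: "f (lin_of (\<mu> g) v) = lin_of (\<mu> g) (f v)"
    and Aut_YD_coact: "coact \<theta> emb (f v) = tensor_map id f (coact \<theta> emb v)"
  using f by (auto simp: Aut_YD_Hopf_def bialg_auto_def simp flip: act_delta)

text \<open>
  Eigenvalues are separated by the first factor because \<open>emb\<close> is injective on them.
\<close>

lemma coord_coact:
  assumes "m \<in> Ev"
  shows "coord (\<Sum>l\<in>Ev. tensor (delta (emb l)) (w l)) (emb m, d) = coord (w m) d"
proof -
  have "emb l = emb m \<longleftrightarrow> l = m" if "l \<in> Ev" for l
    using emb_inj Ev_subset_U assms that by (auto dest: inj_onD)
  then have "coord (\<Sum>l\<in>Ev. tensor (delta (emb l)) (w l)) (emb m, d) =
      (\<Sum>l\<in>Ev. if l = m then coord (w m) d else 0)"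
    unfolding coord_sum by (intro sum.cong refl) (auto simp: coord_delta)
  then show ?thesis using assms by (simp add: finite_eigenvalues[OF diag])
qed

lemma Aut_YD_eigenproj:
  assumes "m \<in> Ev" shows "f (E m v) = E m (f v)"
proof (rule coord_eqI)
  fix d
  have "tensor_map id f (coact \<theta> emb v) = (\<Sum>l\<in>Ev. tensor_map id f (tensor (delta (emb l)) (E l v)))"
    unfolding coact_eq by (rule klin.linear_sum) (intro klinear_intros)
  also have "\<dots> = (\<Sum>l\<in>Ev. tensor (delta (emb l)) (f (E l v)))"
    by (simp add: tensor_map_tensor klinear_id klinear_Aut_YD)
  finally have "(\<Sum>l\<in>Ev. tensor (delta (emb l)) (E l (f v))) =
      (\<Sum>l\<in>Ev. tensor (delta (emb l)) (f (E l v)))"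
    using Aut_YD_coact[of v] by (simp add: coact_eq)
  then have "coord (\<Sum>l\<in>Ev. tensor (delta (emb l)) (E l (f v))) (emb m, d) =
      coord (\<Sum>l\<in>Ev. tensor (delta (emb l)) (f (E l v))) (emb m, d)"
    by (rule arg_cong)
  then show "coord (f (E m v)) d = coord (E m (f v)) d"
    unfolding coord_coact[OF assms] by simp
qed

text \<open>
  The image \<open>x\<close> of a group element is group-like, \<open>\<Delta> x = x \<otimes> x\<close>; apply \<open>E m\<close> to the second factor.
\<close>

lemma Aut_YD_grouplike_eigenproj:
  "coord (f (delta b)) c * coord (E m (delta c)) d = coord (f (delta b)) c * coord (E m (f (delta b))) d"
proof -
  let ?x = "f (delta b)"
  have x: "(if c = d' then coord ?x c else 0) = coord ?x c * coord ?x d'" for d'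
    using arg_cong[OF Aut_YD_comult[of "delta b"], of "\<lambda>v. coord v (c, d')"]
    by (simp add: coord_galg_comult)
  have "coord ?x c * coord (E m ?x) d = (\<Sum>d'\<in>UNIV. coord ?x c * coord ?x d' * coord (E m (delta d')) d)"
    unfolding klinear_coord_finite[OF klinear_eigenproj[OF diag], of m ?x]
    by (simp add: sum_distrib_left mult.assoc)
  also have "\<dots> = (\<Sum>d'\<in>UNIV. if d' = c then coord ?x c * coord (E m (delta c)) d else 0)"
    unfolding x[symmetric] by (intro sum.cong refl) auto
  finally show ?thesis by auto
qed

lemma Phi_YD_counit_tensor:
  "Phi_YD (counit_map, f) (tensor b (delta h)) = tensor (f b) (delta h)"
  by (simp add: Phi_tensor[OF klinear_Aut_YD])

text \<open>
  \<open>\<Phi> (1, f)\<close> is \<open>f \<otimes> id\<close>, so each structure map of the biproduct is preserved because \<open>f\<close> preserves the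
  corresponding structure of \<open>B\<close>.
\<close>

lemma Phi_YD_counit_Aut_Hopf: "Phi_YD (counit_map, f) \<in> carrier (Aut_Hopf \<mu> \<theta> emb)"
proof -
  let ?P = "Phi_YD (counit_map, f) :: ('c \<times> 'g \<Rightarrow>\<^sub>0 'k) \<Rightarrow> _"
  note lin = klinear_Phi[of counit_map f]
  have delta: "?P (delta (b, h)) = tensor (f (delta b)) (delta h)" for b h
    using Phi_YD_counit_tensor[of "delta b" h] by simp
  have lin': "klinear (inv_into UNIV f)" by (rule klinear_inv[OF klinear_Aut_YD bij_Aut_YD])
  have P: "?P = tensor_map f id"
    by (rule ext, rule klinear_eqI[OF lin klinear_tensor_map[OF klinear_ident]]) (auto simp: delta)
  have ff': "f \<circ> inv_into UNIV f = id" "inv_into UNIV f \<circ> f = id"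
    using bij_Aut_YD by (auto simp: bij_def fun_eq_iff surj_f_inv_f)
  have "bij ?P"
    unfolding P
    by (rule o_bij[of "tensor_map (inv_into UNIV f) id"])
      (auto simp: fun_eq_iff tensor_map_comp klinear_Aut_YD lin' klinear_id ff' tensor_map_id)
  moreover have "?P (bip_mult \<mu> u v) = bip_mult \<mu> (?P u) (?P v)" for u v
  proof (rule klinear_eq2I[of "\<lambda>u v. ?P (bip_mult \<mu> u v)" "\<lambda>u v. bip_mult \<mu> (?P u) (?P v)"])
    fix x y :: "'c \<times> 'g"
    obtain b g b' g' where xy: "x = (b, g)" "y = (b', g')" by (cases x, cases y)
    have "?P (bip_mult \<mu> (delta x) (delta y)) =
        tensor (f (delta b * lin_of (\<mu> g) (delta b'))) (delta (g + g'))"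
      by (simp add: xy bip_mult_delta delta)
    also have "\<dots> = bip_mult \<mu> (?P (delta x)) (?P (delta y))"
      unfolding Aut_YD_mult Aut_YD_act by (simp only: xy delta bip_mult_tensor)
    finally show "?P (bip_mult \<mu> (delta x) (delta y)) = bip_mult \<mu> (?P (delta x)) (?P (delta y))" .
  qed (intro klinear_compose[OF lin] klinear_bip_mult_left klinear_bip_mult_right lin klinear_ident)+
  moreover have "?P bip_one = bip_one"
    unfolding bip_one_eq Phi_YD_counit_tensor Aut_YD_one ..
  moreover have "bip_comult \<theta> emb (?P v) = tensor_map ?P ?P (bip_comult \<theta> emb v)" for v
  proof (rule klinear_eqI[of "\<lambda>v. bip_comult \<theta> emb (?P v)"])
    fix x :: "'c \<times> 'g"
    obtain b g where x: "x = (b, g)" by (cases x)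
    have "tensor_map ?P ?P (bip_comult \<theta> emb (delta x)) =
      (\<Sum>l\<in>Ev. tensor_map ?P ?P (tensor (delta (b, emb l + g)) (tensor (E l (delta b)) (delta g))))"
      unfolding bip_comult_delta x by (rule klin.linear_sum) (intro klinear_intros)
    also have "\<dots> = (\<Sum>l\<in>Ev. tensor (tensor (f (delta b)) (delta (emb l + g)))
        (tensor (E l (f (delta b))) (delta g)))"
      by (intro sum.cong refl)
        (simp add: tensor_map_tensor lin delta Phi_YD_counit_tensor Aut_YD_eigenproj)
    also have "\<dots> = bip_comult \<theta> emb (tensor (f (delta b)) (delta g))"
    proof (rule coord_eqI)
      fix y :: "('c \<times> 'g) \<times> ('c \<times> 'g)"
      obtain c h d k where y: "y = ((c, h), (d, k))" by (metis surj_pair)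
      show "coord (\<Sum>l\<in>Ev. tensor (tensor (f (delta b)) (delta (emb l + g)))
          (tensor (E l (f (delta b))) (delta g))) y =
        coord (bip_comult \<theta> emb (tensor (f (delta b)) (delta g))) y"
        unfolding y coord_bip_comult_tensor coord_sum
        by (intro sum.cong refl) (simp add: coord_delta Aut_YD_grouplike_eigenproj)
    qed
    finally show "bip_comult \<theta> emb (?P (delta x)) = tensor_map ?P ?P (bip_comult \<theta> emb (delta x))"
      by (simp add: x delta)
  qed (intro klinear_bip_comult klinear_tensor_map lin klinear_ident)+
  moreover have "galg_counit (?P v) = galg_counit v" for v
    by (rule galg_counit_eqI[OF lin klinear_ident])
      (auto simp: delta galg_counit_tensor_delta Aut_YD_counit)
  moreover have "bip_pi (?P v) = bip_pi v" for v
  proof (rule klinear_eqI[of "\<lambda>v. bip_pi (?P v)"])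
    fix x :: "'c \<times> 'g"
    obtain b g where x: "x = (b, g)" by (cases x)
    have "bip_pi (tensor (delta b) (delta g)) = (delta g :: _ \<Rightarrow>\<^sub>0 'k)"
      unfolding bip_pi_tensor by simp
    then show "bip_pi (?P (delta x)) = bip_pi (delta x)"
      by (simp add: x delta bip_pi_tensor Aut_YD_counit)
  qed (intro klinear_bip_pi lin klinear_ident)+
  ultimately show ?thesis
    using lin by (simp add: Aut_Hopf_def bialg_auto_def bip_counit_eq_galg_counit fun_eq_iff)
qed

end

lemma left_part_delta_zero: "left_part F b = bip_Pi (F (tensor b (delta 0)))"
  by (simp add: left_part_def)

text \<open>
  \<open>g\<close> comes from an automorphism \<open>F\<^sub>0\<close> with trivial left part, and then \<open>\<Phi> (g, f) = F\<^sub>0 \<circ> \<Phi> (1, f)\<close>. The parts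
  of \<open>\<Phi> (g, f)\<close> recover \<open>g\<close> and \<open>f\<close>, which makes \<open>\<Phi>\<close> injective.
\<close>

lemma Phi_YD_Aut_Hopf:
  assumes g: "g \<in> carrier (NBH \<mu> \<theta> emb)" and f: "f \<in> carrier (Aut_YD_Hopf \<mu> \<theta> emb)"
  shows "Phi_YD (g, f) \<in> carrier (Aut_Hopf \<mu> \<theta> emb)"
    and "right_part (Phi_YD (g, f)) = g"
    and "left_part (Phi_YD (g, f)) = f"
proof -
  obtain F0 where F0: "F0 \<in> carrier (Aut_Hopf \<mu> \<theta> emb)" "left_part F0 = id" "g = right_part F0"
    using g by (auto simp: NBH_def)
  have "F0 (Phi_YD (counit_map, f) v) = Phi_YD (g, f) v" for v
  proof (rule klinear_eqI[of "\<lambda>v. F0 (Phi_YD (counit_map, f) v)"])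
    fix x :: "'c \<times> 'g"
    obtain b h where x: "x = (b, h)" by (cases x)
    show "F0 (Phi_YD (counit_map, f) (delta x)) = Phi_YD (g, f) (delta x)"
      using Phi_YD_counit_tensor[OF f, of "delta b" h]
      by (simp add: x Phi_delta Aut_Hopf_tensor[OF F0(1)] F0(2,3))
  qed (intro klinear_compose[OF klinear_Aut_Hopf[OF F0(1)]] klinear_Phi)+
  then have "Phi_YD (g, f) = F0 \<circ> Phi_YD (counit_map, f)" by (simp add: fun_eq_iff)
  then show "Phi_YD (g, f) \<in> carrier (Aut_Hopf \<mu> \<theta> emb)"
    using Aut_Hopf_comp[OF F0(1) Phi_YD_counit_Aut_Hopf[OF f]] by simp
  show "left_part (Phi_YD (g, f)) = f"
  proof
    fix b
    have "left_part (Phi_YD (g, f)) b = bip_Pi (tensor (f b * g (delta 0)) (delta 0 :: 'g \<Rightarrow>\<^sub>0 'k))"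
      unfolding left_part_delta_zero Phi_tensor[OF klinear_Aut_YD[OF f]] ..
    also have "g (delta 0) = 1" unfolding F0(3) by (rule right_part_zero[OF F0(1)])
    finally show "left_part (Phi_YD (g, f)) b = f b" by (simp add: bip_Pi_tensor)
  qed
  show "right_part (Phi_YD (g, f)) = g"
  proof
    fix h
    show "right_part (Phi_YD (g, f)) h = g h"
    proof (rule klinear_eqI[of "right_part (Phi_YD (g, f))" g])
      show "klinear (right_part (Phi_YD (g, f)))"
        unfolding right_part_def by (intro klinear_intros klinear_compose[OF klinear_Phi])
      show "klinear g"
        unfolding F0(3) using klinear_right_part[OF F0(1) klinear_ident] by simp
      show "right_part (Phi_YD (g, f)) (delta h) = g (delta h)" for h
        by (simp add: right_part_def Phi_tensor[OF klinear_Aut_YD[OF f]] Aut_YD_one[OF f] bip_Pi_tensor)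
    qed
  qed
qed

lemma Phi_YD_mult:
  fixes g g' :: "('g \<Rightarrow>\<^sub>0 'k) \<Rightarrow> ('c \<Rightarrow>\<^sub>0 'k)"
  assumes f: "f \<in> carrier (Aut_YD_Hopf \<mu> \<theta> emb)"
  shows "Phi_YD (conv (f \<circ> g') g, f \<circ> f') = Phi_YD (g, f) \<circ> Phi_YD (g', f')"
proof
  fix v :: "'c \<times> 'g \<Rightarrow>\<^sub>0 'k"
  have "Phi_YD (conv (f \<circ> g') g, f \<circ> f') v = Phi_YD (g, f) (Phi_YD (g', f') v)"
  proof (rule klinear_eqI[of "Phi_YD (conv (f \<circ> g') g, f \<circ> f')"])
    fix x :: "'c \<times> 'g"
    obtain b h where x: "x = (b, h)" by (cases x)
    show "Phi_YD (conv (f \<circ> g') g, f \<circ> f') (delta x) = Phi_YD (g, f) (Phi_YD (g', f') (delta x))"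
      by (simp add: x Phi_delta Phi_tensor[OF klinear_Aut_YD[OF f]] conv_def Aut_YD_mult[OF f] mult.assoc)
  qed (intro klinear_compose[OF klinear_Phi] klinear_Phi)+
  then show "Phi_YD (conv (f \<circ> g') g, f \<circ> f') v = (Phi_YD (g, f) \<circ> Phi_YD (g', f')) v"
    by simp
qed

text \<open>
  Dividing \<open>F\<close> by \<open>\<Phi> (1, F\<^sub>L)\<close> gives an automorphism with trivial left part and the same right part as
  \<open>F\<close>, so that the right part of \<open>F\<close> belongs to the group of such right parts.
\<close>

lemma Aut_Hopf_factorization:
  assumes F: "F \<in> carrier (Aut_Hopf \<mu> \<theta> emb)"
    and trivial: "\<And>l. l \<in> Ev \<Longrightarrow> shift F (emb l) = 0"
  shows "right_part F \<in> carrier (NBH \<mu> \<theta> emb)"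
    and "F = Phi_YD (right_part F, left_part F)"
proof -
  have L: "left_part F \<in> carrier (Aut_YD_Hopf \<mu> \<theta> emb)" by (rule left_part_Aut_YD[OF F trivial])
  let ?P = "Phi_YD (counit_map, left_part F) :: ('c \<times> 'g \<Rightarrow>\<^sub>0 'k) \<Rightarrow> _"
  note P = Phi_YD_counit_Aut_Hopf[OF L]
  define F0 where "F0 = F \<circ> inv_into UNIV ?P"
  have F0: "F0 \<in> carrier (Aut_Hopf \<mu> \<theta> emb)"
    unfolding F0_def by (rule Aut_Hopf_comp[OF F Aut_Hopf_inv[OF P]])
  have F0_tensor: "F0 (tensor (left_part F b) (delta h)) = F (tensor b (delta h))" for b h
  proof -
    have "tensor (left_part F b) (delta h) = ?P (tensor b (delta h))"
      by (simp only: Phi_YD_counit_tensor[OF L])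
    then show ?thesis using bij_Aut_Hopf[OF P] by (simp add: F0_def bij_def)
  qed
  have "left_part F0 b = b" for b
  proof -
    obtain b' where b': "b = left_part F b'"
      using bij_Aut_YD[OF L] by (meson bij_pointE)
    have "F0 (tensor b (delta 0)) = tensor b (delta 0)"
      unfolding b' F0_tensor Aut_Hopf_left[OF F] ..
    then show ?thesis by (simp add: left_part_delta_zero bip_Pi_tensor del: single_one)
  qed
  then have left: "left_part F0 = id" by (simp add: fun_eq_iff)
  have "right_part F0 h = right_part F h" for h
  proof (rule klinear_eqI[of "right_part F0"])
    show "right_part F0 (delta h) = right_part F (delta h)" for h
      using F0_tensor[of 1 h] by (simp add: right_part_def left_part_one[OF F])
  qed (use klinear_right_part[OF F0 klinear_ident] klinear_right_part[OF F klinear_ident] in simp_all)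
  then have "right_part F = right_part F0" by (simp add: fun_eq_iff)
  then show "right_part F \<in> carrier (NBH \<mu> \<theta> emb)"
    using F0 left by (auto simp: NBH_def)
  show "F = Phi_YD (right_part F, left_part F)"
  proof
    fix v
    show "F v = Phi_YD (right_part F, left_part F) v"
    proof (rule klinear_eqI[OF klinear_Aut_Hopf[OF F] klinear_Phi])
      fix x :: "'c \<times> 'g"
      obtain b h where x: "x = (b, h)" by (cases x)
      show "F (delta x) = Phi_YD (right_part F, left_part F) (delta x)"
        using Aut_Hopf_tensor[OF F, of "delta b" h] by (simp add: x Phi_delta)
    qed
  qed
qed

lemma Phi_YD_iso:
  assumes trivial: "\<And>F l. F \<in> carrier (Aut_Hopf \<mu> \<theta> emb) \<Longrightarrow> l \<in> Ev \<Longrightarrow> shift F (emb l) = 0"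
  shows "Phi_YD \<in> iso
    (semidirect (opposite_group (NBH \<mu> \<theta> emb)) (Aut_YD_Hopf \<mu> \<theta> emb) (\<lambda>f g. f \<circ> g))
    (Aut_Hopf \<mu> \<theta> emb)" (is "_ \<in> iso ?S ?A")
proof -
  have carrier: "carrier ?S = carrier (NBH \<mu> \<theta> emb) \<times> carrier (Aut_YD_Hopf \<mu> \<theta> emb)"
    by (simp add: semidirect_def opposite_group_def)
  have mult: "x \<otimes>\<^bsub>?S\<^esub> y = (conv (snd x \<circ> fst y) (fst x), snd x \<circ> snd y)" for x y
    by (cases x, cases y) (simp add: semidirect_def opposite_group_def NBH_def Aut_YD_Hopf_def)
  have "Phi_YD \<in> hom ?S ?A"
  proof (rule homI)
    fix x assume "x \<in> carrier ?S"
    then show "Phi_YD x \<in> carrier ?A" using Phi_YD_Aut_Hopf(1) by (auto simp: carrier)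
  next
    fix x y assume "x \<in> carrier ?S" "y \<in> carrier ?S"
    then show "Phi_YD (x \<otimes>\<^bsub>?S\<^esub> y) = Phi_YD x \<otimes>\<^bsub>?A\<^esub> Phi_YD y"
      using Phi_YD_mult[of "snd x" "fst y" "fst x" "snd y"]
      by (auto simp: carrier mult Aut_Hopf_def)
  qed
  moreover have "bij_betw Phi_YD (carrier ?S) (carrier ?A)"
  proof (rule bij_betw_byWitness[of _ "\<lambda>F. (right_part F, left_part F)"])
    show "\<forall>x\<in>carrier ?S. (right_part (Phi_YD x), left_part (Phi_YD x)) = x"
      using Phi_YD_Aut_Hopf(2,3) by (auto simp: carrier)
    show "\<forall>F\<in>carrier ?A. Phi_YD (right_part F, left_part F) = F"
      using Aut_Hopf_factorization(2) trivial by metis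
    show "Phi_YD ` carrier ?S \<subseteq> carrier ?A"
      using Phi_YD_Aut_Hopf(1) by (auto simp: carrier)
    show "(\<lambda>F. (right_part F, left_part F)) ` carrier ?A \<subseteq> carrier ?S"
      using Aut_Hopf_factorization(1) left_part_Aut_YD trivial by (auto simp: carrier)
  qed
  ultimately show ?thesis by (simp add: iso_def)
qed

end

section \<open>Characters and orders in finite groups\<close>

lemma group_grp: "group (grp :: 'a::group_add monoid)"
  by (rule groupI) (auto simp: grp_def add.assoc intro: exI[of _ "- _"] left_minus)

lemma grp_simps [simp]:
  "carrier grp = UNIV" "x \<otimes>\<^bsub>grp\<^esub> y = x + y" "\<one>\<^bsub>grp\<^esub> = 0"
  by (simp_all add: grp_def)

interpretation grp: group "grp :: 'a::group_add monoid"
  by (rule group_grp)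

lemma grp_inv: "inv\<^bsub>grp\<^esub> x = - x"
  by (rule grp.inv_equality) auto

abbreviation multiple :: "'a::group_add \<Rightarrow> nat \<Rightarrow> 'a" where
  "multiple x j \<equiv> x [^]\<^bsub>grp\<^esub> j"

lemma multiple_0 [simp]: "multiple x 0 = 0"
  using grp.nat_pow_0[of x] by simp

lemma multiple_Suc: "multiple x (Suc j) = multiple x j + x"
  using grp.nat_pow_Suc[of x j] by simp

lemma multiple_add: "multiple x (i + j) = multiple x i + multiple x j"
  using grp.nat_pow_mult[of x i j] by simp

lemma multiple_mult: "multiple (multiple x i) j = multiple x (i * j)"
  using grp.nat_pow_pow[of x i j] by simp

lemma multiple_CARD: "multiple x CARD('a) = 0" for x :: "'a::{group_add, finite}"
  using grp.pow_order_eq_1[of x] by (simp add: Coset.order_def)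

lemma ord_dvd_CARD: "group.ord grp x dvd CARD('a)" for x :: "'a::{group_add, finite}"
  using grp.pow_eq_id[of x "CARD('a)"] by (simp add: multiple_CARD)

lemma BijGroup_pow:
  assumes "bij f"
  shows "f [^]\<^bsub>BijGroup UNIV\<^esub> (n::nat) = f ^^ n"
proof (induction n)
  case 0
  then show ?case by (simp add: BijGroup_def fun_eq_iff)
next
  case (Suc n)
  interpret group "BijGroup UNIV" by (rule group_BijGroup)
  have Bij: "f ^^ n \<in> Bij UNIV" "f \<in> Bij UNIV"
    using assms by (auto simp: Bij_def bij_fn)
  have "f [^]\<^bsub>BijGroup UNIV\<^esub> (Suc n) = (f ^^ n) \<otimes>\<^bsub>BijGroup UNIV\<^esub> f"
    by (simp add: Suc)
  also have "\<dots> = (f ^^ n) \<circ> f" using Bij by (simp add: BijGroup_def compose_def fun_eq_iff)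
  finally show ?case by (simp add: funpow_Suc_right del: funpow.simps)
qed

lemma funpow_bij_order: "bij f \<Longrightarrow> f ^^ bij_order f = id"
proof -
  assume f: "bij f"
  interpret group "BijGroup UNIV" by (rule group_BijGroup)
  have "f \<in> carrier (BijGroup UNIV)" using f by (simp add: BijGroup_def Bij_def)
  from pow_ord_eq_1[OF this] have "f ^^ bij_order f = \<one>\<^bsub>BijGroup UNIV\<^esub>"
    unfolding bij_order_def BijGroup_pow[OF f] .
  also have "\<dots> = id" by (simp add: BijGroup_def fun_eq_iff)
  finally show ?thesis .
qed

lemma bij_order_id: "bij_order id = 1"
proof -
  interpret group "BijGroup UNIV" by (rule group_BijGroup)
  have "id = \<one>\<^bsub>BijGroup UNIV\<^esub>" by (simp add: BijGroup_def fun_eq_iff)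
  then show ?thesis unfolding bij_order_def using ord_id by metis
qed

lemma submonoid_multiple:
  assumes "0 \<in> M" "\<And>x y. x \<in> M \<Longrightarrow> y \<in> M \<Longrightarrow> x + y \<in> M" "x \<in> M"
  shows "multiple x j \<in> M"
  by (induction j) (auto simp: multiple_Suc assms)

text \<open>
  Inverses are multiples in a finite group.
\<close>

lemma submonoid_uminus:
  fixes M :: "'a::{group_add, finite} set"
  assumes "0 \<in> M" "\<And>x y. x \<in> M \<Longrightarrow> y \<in> M \<Longrightarrow> x + y \<in> M" "x \<in> M"
  shows "- x \<in> M"
proof -
  have "multiple x (CARD('a) - 1) + x = multiple x (Suc (CARD('a) - 1))"
    by (simp add: multiple_Suc del: Suc_pred)
  also have "Suc (CARD('a) - 1) = CARD('a)" by simp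
  also have "multiple x CARD('a) = 0" by (rule multiple_CARD)
  finally have "multiple x (CARD('a) - 1) = - x" by (simp only: eq_neg_iff_add_eq_0)
  then show ?thesis using submonoid_multiple[OF assms] by metis
qed

text \<open>
  Enlarge \<open>H\<close> to a maximal proper subgroup \<open>M\<close>. The quotient by \<open>M\<close> is cyclic, generated by the class of any
  \<open>x\<close> outside \<open>M\<close>, and its order \<open>p\<close> divides the order of the group. So \<open>x \<mapsto> \<omega>\<close>, for \<open>\<omega>\<close> the power of \<open>w\<close>
  of order \<open>p\<close>, extends to a character trivial on \<open>M\<close>.
\<close>

lemma nontrivial_character:
  fixes H :: "'a::{ab_group_add, finite} set" and w :: "'k::field"
  assumes w: "primitive_root_of_unity CARD('a) w"
    and H: "0 \<in> H" "\<And>x y. x \<in> H \<Longrightarrow> y \<in> H \<Longrightarrow> x + y \<in> H" "H \<noteq> UNIV"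
  shows "\<exists>\<chi> :: 'a \<Rightarrow> 'k. \<chi> 0 = 1 \<and> (\<forall>x y. \<chi> (x + y) = \<chi> x * \<chi> y) \<and>
    (\<forall>x\<in>H. \<chi> x = 1) \<and> (\<exists>x. \<chi> x \<noteq> 1)"
proof -
  let ?N = "CARD('a)"
  define S where "S = {M :: 'a set. H \<subseteq> M \<and> 0 \<in> M \<and> (\<forall>x\<in>M. \<forall>y\<in>M. x + y \<in> M) \<and> M \<noteq> UNIV}"
  have "H \<in> S" using H by (auto simp: S_def)
  then obtain M where M: "M \<in> S" and max: "\<And>M'. M' \<in> S \<Longrightarrow> M \<subseteq> M' \<Longrightarrow> M' = M"
    using finite_has_maximal[of S] by (metis finite empty_iff)
  have M0: "0 \<in> M" and Madd: "\<And>x y. x \<in> M \<Longrightarrow> y \<in> M \<Longrightarrow> x + y \<in> M" and HM: "H \<subseteq> M"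
    using M by (auto simp: S_def)
  have Mdiff: "x - y \<in> M" if "x \<in> M" "y \<in> M" for x y
    using Madd[OF that(1) submonoid_uminus[OF M0 Madd that(2)]] by simp
  obtain x where x: "x \<notin> M" using M by (auto simp: S_def)
  \<comment> \<open>By maximality, \<open>M\<close> and \<open>x\<close> generate the whole group.\<close>
  have cover: "\<exists>j. y - multiple x j \<in> M" for y
  proof -
    define K where "K = {y. \<exists>j. y - multiple x j \<in> M}"
    have "M \<subseteq> K" unfolding K_def by (auto intro: exI[of _ 0])
    moreover have "x \<in> K" unfolding K_def by (auto intro!: exI[of _ 1] simp: M0 multiple_Suc)
    moreover have "a + b \<in> K" if ab: "a \<in> K" "b \<in> K" for a b
    proof -
      obtain i j where "a - multiple x i \<in> M" "b - multiple x j \<in> M"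
        using ab by (auto simp: K_def)
      from Madd[OF this] have "a + b - multiple x (i + j) \<in> M"
        by (simp add: multiple_add algebra_simps)
      then show ?thesis by (auto simp: K_def)
    qed
    ultimately have "K \<notin> S" using max[of K] x by auto
    then have "K = UNIV"
      using \<open>M \<subseteq> K\<close> HM M0 \<open>\<And>a b. a \<in> K \<Longrightarrow> b \<in> K \<Longrightarrow> a + b \<in> K\<close> by (auto simp: S_def)
    then show ?thesis by (auto simp: K_def)
  qed
  define p where "p = (LEAST j. 0 < j \<and> multiple x j \<in> M)"
  have "0 < ?N \<and> multiple x ?N \<in> M" by (simp add: multiple_CARD M0)
  then have p: "0 < p" "multiple x p \<in> M"
    unfolding p_def by (rule LeastI2, simp)+
  have p_dvd: "p dvd j" if j: "multiple x j \<in> M" for j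
  proof -
    have "multiple x j = multiple (multiple x p) (j div p) + multiple x (j mod p)"
      by (simp add: multiple_mult flip: multiple_add)
    then have "multiple x (j mod p) = multiple x j - multiple (multiple x p) (j div p)"
      by simp
    then have "multiple x (j mod p) \<in> M"
      using Mdiff[OF j submonoid_multiple[OF M0 Madd p(2)]] by simp
    moreover have "j mod p < p" using p(1) by simp
    ultimately have "j mod p = 0"
      using not_less_Least[of "j mod p" "\<lambda>j. 0 < j \<and> multiple x j \<in> M"] by (auto simp: p_def)
    then show ?thesis by (simp add: dvd_eq_mod_eq_0)
  qed
  have pN: "p dvd ?N" by (rule p_dvd) (simp add: multiple_CARD M0)
  have "p \<noteq> 1" using p(2) x by (auto simp: multiple_Suc)
  define \<omega> where "\<omega> = w ^ (?N div p)"
  have \<omega>p: "\<omega> ^ p = 1"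
    using w pN by (simp add: \<omega>_def primitive_root_of_unity_def flip: power_mult)
  have "0 < ?N div p"
    using dvd_imp_le[OF pN] p(1) by (simp add: div_greater_zero_iff)
  moreover have "?N div p < ?N" using p(1) \<open>p \<noteq> 1\<close> by (intro div_less_dividend) auto
  ultimately have \<omega>1: "\<omega> \<noteq> 1"
    using w by (auto simp: \<omega>_def primitive_root_of_unity_def)
  \<comment> \<open>The value \<open>\<omega> ^ j\<close> does not depend on the multiple of \<open>x\<close> used to reach \<open>y\<close>, since \<open>\<omega> ^ p = 1\<close>.\<close>
  have le: "\<omega> ^ i = \<omega> ^ j" if "y - multiple x i \<in> M" "y - multiple x j \<in> M" "i \<le> j" for y i j
  proof -
    have "multiple x j = multiple x i + multiple x (j - i)"
      using that(3) by (simp flip: multiple_add)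
    then have "multiple x (j - i) = (y - multiple x i) - (y - multiple x j)" by simp
    then have "p dvd j - i" using Mdiff[OF that(1,2)] by (intro p_dvd) simp
    then obtain q where "j - i = p * q" by (elim dvdE)
    then have "j = i + p * q" using that(3) by simp
    then show ?thesis by (simp add: power_add power_mult \<omega>p)
  qed
  define \<chi> where "\<chi> y = \<omega> ^ (SOME j. y - multiple x j \<in> M)" for y
  have \<chi>: "\<chi> y = \<omega> ^ j" if "y - multiple x j \<in> M" for y j
  proof -
    have "y - multiple x (SOME j. y - multiple x j \<in> M) \<in> M" by (rule someI_ex[OF cover])
    then show ?thesis unfolding \<chi>_def using le[OF _ that] le[OF that] by (metis nle_le)
  qed
  show ?thesis
  proof (intro exI[of _ \<chi>] conjI allI ballI)
    show "\<chi> 0 = 1" using \<chi>[of 0 0] M0 by simp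
    show "\<chi> (a + b) = \<chi> a * \<chi> b" for a b
    proof -
      obtain i j where ij: "a - multiple x i \<in> M" "b - multiple x j \<in> M" using cover by metis
      from Madd[OF this] have "a + b - multiple x (i + j) \<in> M"
        by (simp add: multiple_add algebra_simps)
      from \<chi>[OF this] show ?thesis by (simp add: \<chi>[OF ij(1)] \<chi>[OF ij(2)] power_add)
    qed
    show "\<chi> y = 1" if "y \<in> H" for y using \<chi>[of y 0] HM that by auto
    have "\<chi> x = \<omega>" using \<chi>[of x 1] M0 by (simp add: multiple_Suc)
    then show "\<exists>x. \<chi> x \<noteq> 1" using \<omega>1 by metis
  qed
qed

definition character_vector :: "('a::finite \<Rightarrow> 'k::field) \<Rightarrow> ('a \<Rightarrow>\<^sub>0 'k)" where
  "character_vector \<chi> = (\<Sum>b\<in>UNIV. scale (\<chi> b) (delta b))"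

lemma coord_character_vector [simp]: "coord (character_vector \<chi>) b = \<chi> b"
  by (simp add: character_vector_def coord_sum coord_delta if_distrib cong: if_cong)

text \<open>
  The vector of values of a character is a common eigenvector of all group elements.
\<close>

lemma delta_mult_character_vector:
  fixes \<chi> :: "'a::{ab_group_add, finite} \<Rightarrow> 'k::field"
  assumes "\<And>x y. \<chi> (x + y) = \<chi> x * \<chi> y"
  shows "delta x * character_vector \<chi> = scale (\<chi> (- x)) (character_vector \<chi>)"
proof -
  have "delta x * character_vector \<chi> = (\<Sum>b\<in>UNIV. scale (\<chi> b) (delta (x + b)))"
    by (simp add: character_vector_def sum_distrib_left scale_mult_right mult_single)
  also have "\<dots> = (\<Sum>b\<in>UNIV. scale (\<chi> (- x + b)) (delta b))"
    by (rule sum.reindex_bij_witness[of _ "\<lambda>b. - x + b" "\<lambda>b. x + b"]) auto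
  also have "\<dots> = scale (\<chi> (- x)) (character_vector \<chi>)"
    unfolding assms by (simp add: character_vector_def fm.scale_sum_right)
  finally show ?thesis .
qed

text \<open>
  Group elements multiply the character vector by scalars, so its line is an ideal.
\<close>

lemma one_dim_ideal_character:
  fixes \<chi> :: "'a::{ab_group_add, finite} \<Rightarrow> 'k::field"
  assumes "\<chi> 0 = 1" and mult: "\<And>x y. \<chi> (x + y) = \<chi> x * \<chi> y"
  shows "one_dim_ideal (range (\<lambda>a. scale a (character_vector \<chi>)))"
proof -
  let ?v = "character_vector \<chi>" and ?R = "ring_of_type_algebra :: ('a \<Rightarrow>\<^sub>0 'k) ring"
  let ?I = "range (\<lambda>a. scale a ?v)"
  interpret R: ring ?R by (rule ring_from_type_algebra)
  have v0: "?v \<noteq> 0" using coord_character_vector[of \<chi> 0] assms(1) by (metis lookup_zero zero_neq_one)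
  have smult: "u * ?v = scale (\<Sum>x\<in>Poly_Mapping.keys u. coord u x * \<chi> (- x)) ?v" for u
  proof -
    have "u * ?v = lin_ext delta u * ?v" by (simp add: lin_ext_delta_id)
    also have "\<dots> = (\<Sum>x\<in>Poly_Mapping.keys u. scale (coord u x) (delta x * ?v))"
      by (simp add: lin_ext_def sum_distrib_right scale_mult_left)
    finally show ?thesis
      by (simp add: delta_mult_character_vector[OF mult] fm.scale_sum_left)
  qed
  have "ideal ?I ?R"
  proof (rule idealI)
    show "ring ?R" by (rule R.ring_axioms)
    show "subgroup ?I (add_monoid ?R)"
    proof (rule R.add.subgroupI)
      fix a assume "a \<in> ?I"
      then obtain c where c: "a = scale c ?v" by auto
      have "\<ominus>\<^bsub>?R\<^esub> a = scale (- c) ?v"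
        by (rule R.minus_equality)
          (simp_all add: ring_of_type_algebra_def c flip: fm.scale_left_distrib)
      then show "\<ominus>\<^bsub>?R\<^esub> a \<in> ?I" by (metis rangeI)
    next
      fix a b assume "a \<in> ?I" "b \<in> ?I"
      then show "a \<oplus>\<^bsub>?R\<^esub> b \<in> ?I"
        by (auto simp: ring_of_type_algebra_def simp flip: fm.scale_left_distrib)
    qed (auto simp: ring_of_type_algebra_def)
  next
    fix a u assume "a \<in> ?I"
    then obtain c where c: "a = scale c ?v" by auto
    show "u \<otimes>\<^bsub>?R\<^esub> a \<in> ?I" "a \<otimes>\<^bsub>?R\<^esub> u \<in> ?I"
      by (auto simp: ring_of_type_algebra_def c scale_mult_right smult mult.commute[of _ u])
  qed
  moreover have "fm.dim ?I = 1"
    using fm.dim_span_eq_card_independent[of "{?v}"] v0 by (simp add: fm.span_singleton)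
  ultimately show ?thesis by (simp add: one_dim_ideal_def)
qed

lemma subgroup_element_ord_dvd_card:
  fixes K :: "'a::{group_add, finite} set"
  assumes "subgroup K grp" "x \<in> K"
  shows "group.ord grp x dvd card K"
proof -
  interpret K: group "grp\<lparr>carrier := K\<rparr>" by (rule grp.subgroup_imp_group[OF assms(1)])
  have "x [^]\<^bsub>grp\<lparr>carrier := K\<rparr>\<^esub> Coset.order (grp\<lparr>carrier := K\<rparr>) = 0"
    using K.pow_order_eq_1[of x] assms(2) by simp
  then have "multiple x (card K) = 0"
    by (simp add: Coset.order_def flip: grp.nat_pow_consistent)
  then show ?thesis using grp.pow_eq_id[of x "card K"] by simp
qed

text \<open>
  All nonempty fibers of a homomorphism are translates of its kernel.
\<close>

lemma card_kernel_times_card_range: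
  fixes D :: "'a::{group_add, finite} \<Rightarrow> 'b::group_add"
  assumes add: "\<And>x y. D (x + y) = D x + D y"
  shows "CARD('a) = card (range D) * card {x. D x = 0}"
proof -
  have fiber: "card {x. D x = D b} = card {x. D x = 0}" for b
  proof -
    have "D (- b + x) = 0 \<longleftrightarrow> D x = D b" for x
      using add[of b "- b + x"] by (simp flip: add.assoc) (metis add.right_neutral add_left_cancel)
    moreover have "D (b + x) = D b" if "D x = 0" for x by (simp add: add that)
    ultimately have "{x. D x = D b} = (+) b ` {x. D x = 0}"
      by (auto intro!: image_eqI[of _ _ "- b + _"] simp flip: add.assoc)
    then show ?thesis by (simp add: card_image)
  qed
  have "CARD('a) = (\<Sum>y\<in>range D. card {x. D x = y})"
    using sum.image_gen[of UNIV "\<lambda>_. 1::nat" D] by simp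
  also have "\<dots> = (\<Sum>y\<in>range D. card {x. D x = 0})"
    by (intro sum.cong refl) (auto simp: fiber)
  finally show ?thesis by simp
qed

section \<open>Triviality of the shifts\<close>

context abelian_biproduct
begin

lemma lin_of_lin_of:
  fixes v :: "'x \<Rightarrow>\<^sub>0 'k"
  shows "lin_of f' (lin_of f v) = lin_of (\<lambda>x. f' (f x)) v"
  by (rule klinear_eqI[of "\<lambda>v. lin_of f' (lin_of f v)" "lin_of (\<lambda>x. f' (f x))"])
    (use klinear_lin_of[OF klinear_ident] in \<open>auto intro!: klinear_lin_of klinear_ident\<close>)

lemma lin_of_ident: "lin_of (\<lambda>x. x) v = v"
  by (simp add: lin_of_def lin_ext_delta_id)

lemma bij_T: "bij T"
proof (rule o_bij[of "lin_of (inv_into UNIV \<theta>)"])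
  have "inv_into UNIV \<theta> (\<theta> x) = x" "\<theta> (inv_into UNIV \<theta> x) = x" for x
    using bij_\<theta> by (auto simp: bij_def surj_f_inv_f)
  then show "T \<circ> lin_of (inv_into UNIV \<theta>) = id" "lin_of (inv_into UNIV \<theta>) \<circ> T = id"
    by (simp_all add: fun_eq_iff lin_of_lin_of lin_of_ident)
qed

lemma eigenvalue_power_order:
  assumes "l \<in> Ev" shows "l ^ bij_order T = 1"
proof -
  obtain v where v: "v \<noteq> 0" "T v = scale l v"
    using assms zero_in_eigenspace[of T l] klinear_lin_of[OF klinear_ident, of \<theta>]
    by (auto simp: eigenvalues_def eigenspace_def)
  have "(T ^^ n) v = scale (l ^ n) v" for n
    by (induction n)
      (auto simp: klin.linear_scale[OF klinear_lin_of[OF klinear_ident]] v(2) mult.commute)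
  from this[of "bij_order T"] have "scale (l ^ bij_order T) v = scale 1 v"
    by (simp add: funpow_bij_order[OF bij_T])
  then show ?thesis using v(1) by (metis fm.scale_cancel_right)
qed

lemma power_in_U: "l \<in> U \<Longrightarrow> l ^ n \<in> U"
  by (induction n) (auto simp: one_in_U mult_in_U)

lemma shift_emb_power:
  assumes F: "F \<in> carrier (Aut_Hopf \<mu> \<theta> emb)" and "l \<in> U"
  shows "shift F (emb (l ^ n)) = multiple (shift F (emb l)) n"
  using assms(2)
  by (induction n)
    (auto simp: shift_zero[OF F] shift_emb_mult[OF F] power_in_U multiple_Suc add.commute)

lemma multiple_shift_order:
  assumes F: "F \<in> carrier (Aut_Hopf \<mu> \<theta> emb)" and "l \<in> Ev"
  shows "multiple (shift F (emb l)) (bij_order T) = 0"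
  using shift_emb_power[OF F, of l "bij_order T"] assms(2) Ev_subset_U
  by (auto simp: eigenvalue_power_order shift_zero[OF F])

text \<open>
  The order of the shift divides the order of \<open>T\<close>, since \<open>l\<close> is a root of unity of that order, and it
  divides the order of the group.
\<close>

lemma shift_trivial_coprime:
  assumes "coprime (bij_order T) CARD('c)"
    and F: "F \<in> carrier (Aut_Hopf \<mu> \<theta> emb)" and l: "l \<in> Ev"
  shows "shift F (emb l) = 0"
proof -
  have "group.ord grp (shift F (emb l)) dvd bij_order T"
    using multiple_shift_order[OF F l] grp.pow_eq_id[of "shift F (emb l)" "bij_order T"] by simp
  then have "group.ord grp (shift F (emb l)) = 1"
    using assms(1) ord_dvd_CARD coprime_common_divisor_nat by blast
  then show ?thesis using grp.ord_eq_1[of "shift F (emb l)"] by simp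
qed

text \<open>
  A nonzero fixed point makes \<open>\<theta> - 1\<close> neither injective nor surjective. A nontrivial character that is
  trivial on its image is \<open>\<theta>\<close>-invariant, so its line and the line of the trivial character are two
  different \<open>T\<close>-stable ideals.
\<close>

lemma fixed_points_trivial:
  assumes unique: "\<exists>!I :: ('c \<Rightarrow>\<^sub>0 'k) set. one_dim_ideal I \<and> T ` I = I"
    and root: "\<exists>w::'k. primitive_root_of_unity CARD('c) w"
    and fixed: "\<theta> c = c"
  shows "c = 0"
proof (rule ccontr)
  assume "c \<noteq> 0"
  define D where "D x = \<theta> x - x" for x
  have D_add: "D (x + y) = D x + D y" for x y by (simp add: D_def \<theta>_add)
  have "D c = D 0" using fixed by (simp add: D_def)
  then have "\<not> inj D" using \<open>c \<noteq> 0\<close> by (auto dest: injD)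
  then have proper: "range D \<noteq> UNIV" using finite_UNIV_surj_inj[of D] by auto
  have zero: "0 \<in> range D" by (auto simp: D_def intro!: image_eqI[of _ _ 0])
  have add: "x + y \<in> range D" if "x \<in> range D" "y \<in> range D" for x y
    using that by (auto simp flip: D_add)
  obtain w :: 'k where w: "primitive_root_of_unity CARD('c) w" using root by blast
  from nontrivial_character[OF w zero add proper] obtain \<chi> :: "'c \<Rightarrow> 'k" where \<chi>: "\<chi> 0 = 1" "\<And>x y. \<chi> (x + y) = \<chi> x * \<chi> y"
    "\<And>x. x \<in> range D \<Longrightarrow> \<chi> x = 1" and nontrivial: "\<exists>x. \<chi> x \<noteq> 1"
    by blast
  let ?I = "\<lambda>\<chi> :: 'c \<Rightarrow> 'k. range (\<lambda>a. scale a (character_vector \<chi>))"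
  have invariant: "T ` ?I \<psi> = ?I \<psi>" if "\<And>x. \<psi> (\<theta> x) = \<psi> x" for \<psi>
  proof -
    have "T (character_vector \<psi>) = character_vector \<psi>"
    proof (rule coord_eqI)
      fix y
      obtain x where "y = \<theta> x" using bij_\<theta> by (meson bij_pointE)
      then show "coord (T (character_vector \<psi>)) y = coord (character_vector \<psi>) y"
        by (simp add: coord_T that)
    qed
    then show ?thesis
      by (simp add: image_image klin.linear_scale[OF klinear_lin_of[OF klinear_ident]])
  qed
  have "\<chi> (\<theta> x) = \<chi> x" for x
    using \<chi>(2)[of "D x" x] \<chi>(3)[of "D x"] by (simp add: D_def)
  then have "one_dim_ideal (?I \<chi>) \<and> T ` ?I \<chi> = ?I \<chi>"
    using one_dim_ideal_character[OF \<chi>(1,2)] invariant by blast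
  moreover have "one_dim_ideal (?I (\<lambda>_. 1)) \<and> T ` ?I (\<lambda>_. 1) = ?I (\<lambda>_. 1)"
    using one_dim_ideal_character[of "\<lambda>_. 1"] invariant by simp
  ultimately have "?I \<chi> = ?I (\<lambda>_. 1)" using unique by blast
  moreover have "character_vector \<chi> \<in> ?I \<chi>" by (metis fm.scale_one rangeI)
  ultimately obtain a where "character_vector \<chi> = scale a (character_vector (\<lambda>_. 1))" by auto
  then have "\<chi> x = a" for x
    using arg_cong[of _ _ "\<lambda>v. coord v x"] by (metis coord_character_vector lookup_scale mult.right_neutral)
  then show False using \<chi>(1) nontrivial by metis
qed

text \<open>
  \<open>E 1 b\<close> is constant on the orbit of \<open>b\<close>, and its coefficients over that orbit add up to \<open>1\<close>.
\<close>

lemma coord_eigenproj_one_ne_zero: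
  "coord (E 1 (delta b)) (\<theta> b) \<noteq> 0"
proof
  assume "coord (E 1 (delta b)) (\<theta> b) = 0"
  let ?e = "coord (E 1 (delta b))"
  have inv: "?e (\<theta> x) = ?e x" for x
    using coord_T[of "E 1 (delta b)" x] by (simp add: eigenproj_in_eigenspace[OF diag])
  let ?O = "range (\<lambda>n. (\<theta> ^^ n) b)"
  have "\<theta> ` ?O \<subseteq> ?O"
    by (auto intro!: image_eqI[of _ _ "Suc _"])
  moreover have "inj_on \<theta> ?O" using bij_\<theta> by (auto simp: bij_def intro: inj_on_subset)
  ultimately have "\<theta> ` ?O = ?O" by (intro endo_inj_surj) auto
  then have "(\<Sum>x\<in>?O. ?e x) = (\<Sum>x\<in>?O. coord (delta b :: _ \<Rightarrow>\<^sub>0 'k) x)"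
    using invariant_functional_eigenproj[of ?O 1 "delta b"] by simp
  also have "\<dots> = 1"
  proof -
    have "b \<in> ?O" by (rule image_eqI[of _ _ 0]) auto
    then show ?thesis by (simp add: coord_delta)
  qed
  moreover have "?e x = 0" if "x \<in> ?O" for x
  proof -
    have "?e ((\<theta> ^^ n) b) = ?e b" for n by (induction n) (auto simp: inv)
    then show ?thesis using that inv \<open>?e (\<theta> b) = 0\<close> by auto
  qed
  ultimately show False by simp
qed

text \<open>
  A field contains at most \<open>p\<close> roots of \<open>X\<^sup>p - 1\<close>, so \<open>p\<close> distinct powers of \<open>z\<close> exhaust them.
\<close>

lemma roots_of_unity_powers:
  fixes z :: 'k
  assumes "p > 0" "z ^ p = 1" "inj_on (\<lambda>j. z ^ j) {..<p}" "l ^ p = 1"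
  obtains j where "j < p" "l = z ^ j"
proof -
  let ?q = "monom (1::'k) p - 1"
  have deg: "degree ?q = p" 
    using assms(1) degree_add_eq_left[of "- 1" "monom (1::'k) p"] by (simp add: degree_monom_eq)
  then have q0: "?q \<noteq> 0" using assms(1) by auto
  have roots: "{x. poly ?q x = 0} = {x. x ^ p = 1}" by (simp add: poly_monom)
  have fin: "finite {x::'k. x ^ p = 1}"
    using poly_roots_finite[OF q0] unfolding roots .
  have bound: "card {x::'k. x ^ p = 1} \<le> p"
    using card_poly_roots_bound[OF q0] unfolding roots deg .
  have sub: "(\<lambda>j. z ^ j) ` {..<p} \<subseteq> {x. x ^ p = 1}"
    using assms(2) by (auto simp: power_mult simp flip: power_mult) (metis mult.commute power_mult power_one)
  have "(\<lambda>j. z ^ j) ` {..<p} = {x. x ^ p = 1}"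
    by (rule card_seteq[OF fin sub]) (use bound in \<open>simp add: card_image assms(3)\<close>)
  then show ?thesis using that assms(4) by blast
qed

text \<open>
  If the shift at \<open>l0\<close> is nonzero, then so is \<open>s l0\<close>, and all eigenvalues are powers of \<open>l0\<close>, on which \<open>s\<close>
  is injective. Symmetry of the twisted coproduct then makes \<open>\<theta> b - b\<close> a value of \<open>s\<close> for every \<open>b\<close>. Hence
  both the kernel and the image of \<open>\<theta> - 1\<close> have elements of order \<open>p\<close>, and \<open>p\<^sup>2\<close> divides the order of the
  group.
\<close>

lemma shift_trivial_prime_order:
  assumes p: "prime p" "bij_order T = p" "\<not> p\<^sup>2 dvd CARD('c)"
    and F: "F \<in> carrier (Aut_Hopf \<mu> \<theta> emb)" and l0: "l0 \<in> Ev"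
  shows "shift F (emb l0) = 0"
proof (rule ccontr)
  assume nonzero: "shift F (emb l0) \<noteq> 0"
  let ?F' = "inv_into UNIV F"
  note F' = Aut_Hopf_inv[OF F]
  define s where "s m = - shift ?F' (emb m)" for m
  have l0U: "l0 \<in> U" using l0 Ev_subset_U by auto
  have \<theta>_neg: "\<theta> (- x) = - \<theta> x" for x
    using \<theta>_add[of x "- x"] by (simp add: eq_neg_iff_add_eq_0 add.commute)
  have s_fixed: "\<theta> (s m) = s m" for m by (simp add: s_def \<theta>_neg \<theta>_shift[OF F'])
  have s_one: "s 1 = 0" by (simp add: s_def shift_zero[OF F'])
  have s_mult: "s (l * m) = s l + s m" if "l \<in> U" "m \<in> U" for l m
    using that by (simp add: s_def shift_emb_mult[OF F'])
  have s_power: "s (l ^ n) = multiple (s l) n" if "l \<in> U" for l n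
    using that
    by (induction n) (auto simp: s_one s_mult power_in_U multiple_Suc add.commute)
  have s_order: "multiple (s m) p = 0" if "m \<in> Ev" for m
    using s_power[of m p] that Ev_subset_U eigenvalue_power_order[OF that] p(2) s_one by auto
  have "s l0 \<noteq> 0"
  proof
    assume "s l0 = 0"
    then have "left_part ?F' (delta (shift F (emb l0))) = left_part ?F' (delta 0)"
      using left_part_inv_shift[OF F, of "emb l0"] left_part_one[OF F'] by (simp add: s_def)
    then have "delta (shift F (emb l0)) = (delta 0 :: _ \<Rightarrow>\<^sub>0 'k)"
      by (metis left_part_inv(2)[OF F])
    then show False using nonzero by (simp only: delta_inject)
  qed
  have ord: "group.ord grp x = p" if "multiple x p = 0" "x \<noteq> 0" for x :: 'c
    using that grp.pow_eq_id[of x p] grp.ord_eq_1[of x] p(1) by (auto simp: prime_nat_iff)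
  have "inj_on (\<lambda>j. s (l0 ^ j)) {..<p}"
  proof -
    have "{..<p} = {0..p - 1}" using prime_gt_0_nat[OF p(1)] by auto
    then show ?thesis
      using grp.ord_inj[of "s l0"] ord[OF s_order[OF l0] \<open>s l0 \<noteq> 0\<close>] by (simp add: s_power[OF l0U])
  qed
  then have inj: "inj_on (\<lambda>j. l0 ^ j) {..<p}" "inj_on s ((\<lambda>j. l0 ^ j) ` {..<p})"
    by (auto simp: inj_on_def)
  \<comment> \<open>The eigenvalues are \<open>p\<close>-th roots of unity, and the powers of \<open>l0\<close> already are \<open>p\<close> of them.\<close>
  have "m \<in> (\<lambda>j. l0 ^ j) ` {..<p}" if "m \<in> Ev" for m
    using roots_of_unity_powers[OF prime_gt_0_nat[OF p(1)] _ inj(1)]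
      eigenvalue_power_order[OF l0] eigenvalue_power_order[OF that] p(2) by (metis imageI lessThan_iff)
  then have s_zero: "s m = 0 \<longleftrightarrow> m = 1" if "m \<in> Ev" for m
    using inj(2) that one_in_Ev s_one by (metis inj_onD)
  have translate: "\<exists>m\<in>Ev. \<theta> b = b + s m" for b
  proof (rule ccontr)
    assume none: "\<not> (\<exists>m\<in>Ev. \<theta> b = b + s m)"
    \<comment> \<open>\<open>b \<otimes> \<theta> b\<close> occurs in the twisted coproduct of \<open>b\<close> with the coefficient of \<open>\<theta> b\<close> in \<open>E 1 b\<close>, so
      \<open>\<theta> b \<otimes> b\<close> must occur as well.\<close>
    have Y: "coord (\<Sum>m\<in>Ev. tensor (delta (b + s m)) (E m (delta b))) (u, v) =
        (\<Sum>m\<in>Ev. if u = b + s m then coord (E m (delta b)) v else 0)" for u v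
      unfolding coord_sum by (intro sum.cong refl) (auto simp: coord_delta)
    have "coord (E 1 (delta b)) (\<theta> b) = (\<Sum>m\<in>Ev. if m = 1 then coord (E 1 (delta b)) (\<theta> b) else 0)"
      using one_in_Ev by (simp add: finite_eigenvalues[OF diag])
    also have "\<dots> = (\<Sum>m\<in>Ev. if b = b + s m then coord (E m (delta b)) (\<theta> b) else 0)"
      by (intro sum.cong refl) (auto simp: s_zero)
    also have "\<dots> = (\<Sum>m\<in>Ev. if \<theta> b = b + s m then coord (E m (delta b)) b else 0)"
      using twisted_comult_symmetric[OF F, of b b "\<theta> b"] unfolding Y s_def[symmetric] .
    also have "\<dots> = 0" using none by (intro sum.neutral) auto
    finally show False using coord_eigenproj_one_ne_zero by blast
  qed
  define D where "D x = \<theta> x - x" for x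
  have D_add: "D (x + y) = D x + D y" for x y by (simp add: D_def \<theta>_add)
  have D_order: "multiple (D b) p = 0" for b
    using translate[of b] s_order by (auto simp: D_def)
  have ker: "subgroup {x. D x = 0} grp"
    by (rule grp.subgroupI) (auto simp: D_def \<theta>_add \<theta>_neg grp_inv intro: exI[of _ 0])
  have ran: "subgroup (range D) grp"
  proof (rule grp.subgroupI)
    show "inv\<^bsub>grp\<^esub> a \<in> range D" if "a \<in> range D" for a
      using that D_add by (auto simp: grp_inv D_def \<theta>_neg intro!: image_eqI[of _ _ "- _"])
    show "a \<otimes>\<^bsub>grp\<^esub> b \<in> range D" if "a \<in> range D" "b \<in> range D" for a b
      using that by (auto simp flip: D_add)
  qed auto
  have "\<theta> \<noteq> id"
  proof
    assume "\<theta> = id"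
    then have "T v = v" for v using lin_of_ident[of v] by (simp only: id_def)
    then have "T = id" by (simp add: fun_eq_iff)
    then show False using prime_gt_1_nat[OF p(1)] p(2) by (simp add: bij_order_id)
  qed
  then obtain b where "D b \<noteq> 0" by (auto simp: D_def fun_eq_iff)
  then have "p dvd card (range D)"
    using subgroup_element_ord_dvd_card[OF ran, of "D b"] ord[OF D_order] by simp
  moreover have "p dvd card {x. D x = 0}"
    using subgroup_element_ord_dvd_card[OF ker, of "s l0"] ord[OF s_order[OF l0] \<open>s l0 \<noteq> 0\<close>] s_fixed
    by (simp add: D_def)
  ultimately have "p\<^sup>2 dvd CARD('c)"
    using card_kernel_times_card_range[of D, OF D_add] by (simp add: power2_eq_square mult_dvd_mono)
  then show False using p(3) by blast
qed

end

theorem theorem11: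
  fixes \<mu> :: "'g::group_add \<Rightarrow> 'c::{ab_group_add, finite} \<Rightarrow> 'c"
    and \<theta> :: "'c \<Rightarrow> 'c"
    and emb :: "'k::field \<Rightarrow> 'g"
    and V :: "'g set"
  assumes "biproduct_data \<mu> \<theta> emb V"
    and "\<exists>w::'k. primitive_root_of_unity CARD('c) w"
    and "(\<exists>!I :: ('c \<Rightarrow>\<^sub>0 'k) set. one_dim_ideal I \<and> lin_of \<theta> ` I = I)
       \<or> coprime (bij_order (lin_of \<theta> :: ('c \<Rightarrow>\<^sub>0 'k) \<Rightarrow> _)) CARD('c)
       \<or> (\<exists>p. prime p \<and> bij_order (lin_of \<theta> :: ('c \<Rightarrow>\<^sub>0 'k) \<Rightarrow> _) = p \<and> \<not> p\<^sup>2 dvd CARD('c))"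
  shows "Phi_YD \<in> iso
           (semidirect (opposite_group (NBH \<mu> \<theta> emb)) (Aut_YD_Hopf \<mu> \<theta> emb) (\<lambda>f g. f \<circ> g))
           (Aut_Hopf \<mu> \<theta> emb)"
proof -
  interpret abelian_biproduct \<mu> \<theta> emb V
    by (simp add: abelian_biproduct_def assms(1))
  show ?thesis
  proof (rule Phi_YD_iso)
    fix F l assume F: "F \<in> carrier (Aut_Hopf \<mu> \<theta> emb)" and l: "l \<in> Ev"
    from assms(3) show "shift F (emb l) = 0"
    proof (elim disjE exE conjE)
      assume "\<exists>!I :: ('c \<Rightarrow>\<^sub>0 'k) set. one_dim_ideal I \<and> T ` I = I"
      then show ?thesis by (rule fixed_points_trivial[OF _ assms(2) \<theta>_shift[OF F]])
    next
      assume "coprime (bij_order T) CARD('c)"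
      then show ?thesis by (rule shift_trivial_coprime[OF _ F l])
    next
      fix p :: nat
      assume "prime p" "bij_order T = p" "\<not> p\<^sup>2 dvd CARD('c)"
      then show ?thesis by (rule shift_trivial_prime_order[OF _ _ _ F l])
    qed
  qed
qed

end
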